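(* Let $q$ be a prime power and $n\ge 2$ an integer. Let $L$ be an $\mathbb{F}_q$-linear set of $\mathrm{PG}(1,q^n)$ such that $\mathbb{F}_q$ is the maximum field of linearity of $L$ and such that its rank with respect to $\mathbb{F}_q$ is $k$, where $k\le n$. Then $|L|\ge q^{k-1}+1$.
   Context: For an $\mathbb{F}_q$-subspace $U$ of the $2$-dimensional $\mathbb{F}_{q^n}$-vector space $V$ underlying $\mathrm{PG}(1,q^n)$, with $\dim_{\mathbb{F}_q}U=k$, the $\mathbb{F}_q$-linear set of rank $k$ defined by $U$ is $L_U=\{\langle \mathbf{u}\rangle_{\mathbb{F}_{q^n}} : \mathbf{u}\in U\setminus\{\mathbf{0}\}\}$. The maximum field of linearity of an $\mathbb{F}_q$-linear set $L$ is $\mathbb{F}_{q^t}$, where $t\mid n$ is the largest integer such that $L=L_W$ for some $\mathbb{F}_{q^t}$-subspace $W$ of $V$. *)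

theory Defs
  imports "HOL-Analysis.Cartesian_Space" "HOL-Number_Theory.Prime_Powers"
begin

text \<open>
  The field of order \<open>q^n\<close> is a type \<open>'a :: {field, finite}\<close> with \<open>CARD('a) = q^n\<close>; the underlying
  vector space of the projective line is \<open>'a^2\<close> with scalar multiplication \<open>(*s)\<close>. Subfields of
  \<open>'a\<close> are sets, so that one can quantify over all of them; consequently the notions of subspace
  and dimension over a subfield are spelled out here, since the library versions take all scalars
  from a type.
\<close>

definition is_subfield :: "'a::field set \<Rightarrow> bool" where
  "is_subfield K \<longleftrightarrow> 0 \<in> K \<and> 1 \<in> K \<and>
     (\<forall>x\<in>K. \<forall>y\<in>K. x + y \<in> K \<and> x * y \<in> K) \<and>
     (\<forall>x\<in>K. - x \<in> K \<and> inverse x \<in> K)"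

definition subspace_over :: "'a::field set \<Rightarrow> ('a^'m) set \<Rightarrow> bool" where
  "subspace_over K U \<longleftrightarrow> 0 \<in> U \<and> (\<forall>u\<in>U. \<forall>v\<in>U. u + v \<in> U) \<and> (\<forall>c\<in>K. \<forall>u\<in>U. c *s u \<in> U)"

definition basis_over :: "'a::field set \<Rightarrow> ('a^'m) set \<Rightarrow> ('a^'m) set \<Rightarrow> bool" where
  "basis_over K U B \<longleftrightarrow> finite B \<and>
     {\<Sum>b\<in>B. c b *s b | c. \<forall>b\<in>B. c b \<in> K} = U \<and>
     (\<forall>c. (\<forall>b\<in>B. c b \<in> K) \<and> (\<Sum>b\<in>B. c b *s b) = 0 \<longrightarrow> (\<forall>b\<in>B. c b = 0))"

definition has_dim_over :: "'a::field set \<Rightarrow> ('a^'m) set \<Rightarrow> nat \<Rightarrow> bool" where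
  "has_dim_over K U k \<longleftrightarrow> (\<exists>B. basis_over K U B \<and> card B = k)"

text \<open>Points of the projective line are the one-dimensional subspaces \<open>vec.span {u}\<close>.\<close>

definition linear_set :: "('a::field^2) set \<Rightarrow> ('a^2) set set" where
  "linear_set U = {vec.span {u} | u. u \<in> U - {0}}"

definition linear_set_over :: "'a::field set \<Rightarrow> ('a^2) set set \<Rightarrow> bool" where
  "linear_set_over K L \<longleftrightarrow> (\<exists>W. subspace_over K W \<and> L = linear_set W)"

definition linear_set_of_rank :: "'a::field set \<Rightarrow> nat \<Rightarrow> ('a^2) set set \<Rightarrow> bool" where
  "linear_set_of_rank K k L \<longleftrightarrow>
     (\<exists>U. subspace_over K U \<and> has_dim_over K U k \<and> L = linear_set U)"

text \<open>The subspaces witnessing linearity over a larger subfield are not required to have any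
  particular rank, nor to be related to a subspace previously used to define \<open>L\<close>.\<close>

definition maximum_field_of_linearity ::
    "nat \<Rightarrow> nat \<Rightarrow> ('a::field^2) set set \<Rightarrow> 'a set \<Rightarrow> bool" where
  "maximum_field_of_linearity q n L F \<longleftrightarrow>
     (\<exists>t. t dvd n \<and> is_subfield F \<and> card F = q ^ t \<and> linear_set_over F L \<and>
        (\<forall>s E. s dvd n \<and> is_subfield E \<and> card E = q ^ s \<and> linear_set_over E L \<longrightarrow> s \<le> t))"

end

theory Submission
  imports Defs "HOL-Analysis.Determinants" "HOL-Computational_Algebra.Polynomial"
begin

text \<open>
  Let \<open>L\<close> be defined by the subspace \<open>U\<close> of order \<open>q ^ k\<close>. Choose two linear forms \<open>\<alpha>\<close>, \<open>\<beta>\<close> as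
  coordinates of the plane. A point other than the one at infinity, \<open>\<alpha> = 0\<close>, is given by its
  parameter \<open>y = \<beta> / \<alpha>\<close>, and it belongs to \<open>L\<close> iff \<open>\<beta> - y \<alpha>\<close> is not injective on \<open>U\<close>; if the point
  has weight \<open>w\<close>, meeting \<open>U\<close> in \<open>q ^ w\<close> vectors, the image has \<open>q ^ (k - w)\<close> elements.

  The first ingredient is a lower bound (\<open>card_zero_values_ge\<close>): if \<open>y\<close> is the parameter of a point
  of \<open>L\<close>, then \<open>L\<close> has at least as many points off infinity as the image of \<open>\<beta> - y \<alpha>\<close> has elements.
  It comes from dividing \<open>\<Prod> (X - v)\<close>, over all \<open>v\<close> in the field, by \<open>\<Prod> (X - \<beta> u + y \<alpha> u)\<close>, over
  \<open>u\<close> in \<open>U\<close>: the coefficients of the remainder are polynomials in \<open>y\<close> of small degree that vanish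
  at all points outside \<open>L\<close>. If some point of \<open>L\<close> has weight one, putting another point of \<open>L\<close> at
  infinity gives \<open>|L| \<ge> q ^ (k - 1) + 1\<close>.

  Otherwise the images have at most \<open>q ^ m\<close> elements for some \<open>m \<le> k - 2\<close>, and equality holds for
  a point of least weight. Then \<open>L\<close> is linear over a larger field, contrary to the hypothesis
  (\<open>linear_over_extension\<close>). Put a point outside \<open>L\<close> at infinity and consider the functions
  \<open>a i = \<alpha> ^ q ^ i\<close> and \<open>b i = \<beta> ^ q ^ i\<close> on \<open>U\<close>, as vectors over the big field. At a point \<open>y\<close> of
  \<open>L\<close> the functions \<open>b i - y ^ q ^ i a i\<close> with \<open>i \<le> m\<close> are linearly dependent. There are at least
  \<open>q ^ m\<close> such points, more than \<open>1 + q + \<dots> + q ^ (m - 1)\<close>, so the powers \<open>y ^ q ^ i\<close> with \<open>i < m\<close> may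
  be replaced by independent parameters (\<open>card_dependent_values_le\<close>), and Rado's theorem produces a
  tight set: a nonempty set \<open>Z\<close> of indices up to \<open>m\<close> such that the functions \<open>a i\<close>, \<open>b i\<close> with \<open>i\<close> in
  \<open>Z\<close> span at most \<open>|Z|\<close> dimensions (\<open>exists_tight_set\<close>).

  The Frobenius map shifts indices and preserves dimensions, and indices count modulo \<open>n\<close>. Adding
  up overlapping shifts of a minimal tight set, moved to begin at \<open>0\<close> and with maximum \<open>M \<le> m\<close>, shows that for some common
  divisor \<open>s\<close> of \<open>n\<close> and \<open>M\<close> all \<open>a i\<close>, \<open>b i\<close> with \<open>s\<close> dividing \<open>i\<close> span at most \<open>d = M / s + 1\<close>
  dimensions (\<open>dim_multiples_le\<close>). Since \<open>a 0, \<dots>, a (k - 1)\<close> are independent, this forces \<open>s > 1\<close>, and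
  it makes \<open>\<alpha> ^ q ^ (s d)\<close> and \<open>\<beta>\<close> combinations of the \<open>\<alpha> ^ q ^ (s i)\<close> with \<open>i < d\<close> on \<open>U\<close>. These two
  equations define a subspace over the field of order \<open>q ^ s\<close> that contains \<open>U\<close> and exceeds it so
  little that it defines the same linear set (\<open>linear_set_over_fixed_field\<close>).
\<close>

section \<open>Powers of the Frobenius map on a finite field\<close>

lemma subfield_power_card:
  fixes K :: "'a::{field, finite} set"
  assumes K: "is_subfield K" and "c \<in> K"
  shows "c ^ card K = c"
proof (cases "c = 0")
  case True
  then show ?thesis using assms by (auto simp: card_gt_0_iff)
next
  case False
  have K0: "0 \<in> K" and inv: "inverse c \<in> K" and mult: "\<And>x y. x \<in> K \<Longrightarrow> y \<in> K \<Longrightarrow> x * y \<in> K"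
    using assms by (auto simp: is_subfield_def)
  have "(\<Prod>y\<in>K-{0}. c * y) = (\<Prod>y\<in>K-{0}. y)"
    by (rule prod.reindex_bij_witness[of _ "\<lambda>y. inverse c * y" "\<lambda>y. c * y"])
      (use False inv mult \<open>c \<in> K\<close> in auto)
  then have "c ^ card (K - {0}) * \<Prod>(K - {0}) = \<Prod>(K - {0})"
    by (simp add: prod.distrib)
  then have "c ^ card (K - {0}) = 1"
    by simp
  moreover have "card K = Suc (card (K - {0}))"
    using K0 by (metis card.remove finite)
  ultimately show ?thesis by simp
qed

lemma field_power_card:
  fixes c :: "'a::{field, finite}"
  shows "c ^ CARD('a) = c"
  by (rule subfield_power_card) (auto simp: is_subfield_def)

lemma freshman_power_field_order:
  fixes x y :: "'a::{field, finite}"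
  assumes q: "primepow q" and card: "CARD('a) = q ^ n"
  shows "(x + y) ^ q = x ^ q + y ^ q"
proof -
  have "(\<Sum>x\<in>UNIV. x + 1) = (\<Sum>x\<in>UNIV. x :: 'a)"
    by (rule sum.reindex_bij_witness[of _ "\<lambda>x. x - 1" "\<lambda>x. x + 1"]) auto
  then have "of_nat CARD('a) = (0 :: 'a)"
    by (simp add: sum.distrib)
  then have dvd: "CHAR('a) dvd CARD('a)"
    by (simp add: of_nat_eq_0_iff_char_dvd)
  have char: "prime CHAR('a)"
    by (simp add: finite_imp_CHAR_pos prime_CHAR_semidom)
  obtain p r where p: "prime p" "q = p ^ r"
    using q by (auto simp: primepow_def)
  have "CHAR('a) dvd p ^ (r * n)"
    using dvd card p by (simp add: power_mult)
  then have "CHAR('a) = p"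
    using char p by (metis prime_dvd_power primes_dvd_imp_eq)
  then show ?thesis
    using char p by (metis freshmans_dream')
qed

locale frobenius_field =
  fixes q n :: nat and F :: "'a::{field, finite} set"
  assumes q_gt_1: "q > 1" and n_pos: "n > 0" and card_field: "CARD('a) = q ^ n"
    and power_q_add: "\<And>x y :: 'a. (x + y) ^ q = x ^ q + y ^ q"
    and subfield_F: "is_subfield F" and card_F: "card F = q"
begin

lemma frob_add: "(x + y :: 'a) ^ q ^ i = x ^ q ^ i + y ^ q ^ i"
proof (induction i)
  case (Suc i)
  have "(x + y) ^ q ^ Suc i = ((x + y) ^ q ^ i) ^ q"
    by (simp add: mult.commute flip: power_mult)
  also have "\<dots> = x ^ q ^ Suc i + y ^ q ^ Suc i"
    unfolding Suc power_q_add by (simp add: mult.commute flip: power_mult)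
  finally show ?case .
qed auto

lemma frob_0 [simp]: "(0 :: 'a) ^ q ^ i = 0"
  using q_gt_1 by simp

lemma frob_minus: "(- x :: 'a) ^ q ^ i = - (x ^ q ^ i)"
proof -
  have "x ^ q ^ i + (- x) ^ q ^ i = 0"
    by (metis frob_add add.right_inverse frob_0)
  then show ?thesis by (simp add: eq_neg_iff_add_eq_0 add.commute)
qed

lemma frob_diff: "(x - y :: 'a) ^ q ^ i = x ^ q ^ i - y ^ q ^ i"
  using frob_add[of x "- y" i] by (simp add: frob_minus)

lemma frob_sum: "(\<Sum>x\<in>A. f x :: 'a) ^ q ^ i = (\<Sum>x\<in>A. f x ^ q ^ i)"
  by (induction A rule: infinite_finite_induct) (auto simp: frob_add)

lemma frob_frob: "((x :: 'a) ^ q ^ i) ^ q ^ j = x ^ q ^ (i + j)"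
  by (simp add: power_add flip: power_mult)

lemma frob_period: "(x :: 'a) ^ q ^ (n * j) = x"
proof (induction j)
  case (Suc j)
  have "x ^ q ^ (n * Suc j) = (x ^ q ^ n) ^ q ^ (n * j)"
    by (simp add: frob_frob)
  also have "\<dots> = x" using Suc field_power_card[of x] card_field by simp
  finally show ?case .
qed auto

lemma frob_add_period: "(x :: 'a) ^ q ^ (i + n * j) = x ^ q ^ i"
  by (metis frob_frob frob_period)

lemma frob_F:
  assumes "c \<in> F" shows "c ^ q ^ i = c"
proof (induction i)
  case (Suc i)
  have "c ^ q ^ Suc i = (c ^ q) ^ q ^ i" by (simp add: power_mult)
  then show ?case using subfield_power_card[OF subfield_F assms] card_F Suc by simp
qed auto

lemma fixed_field_subfield: "is_subfield {x :: 'a. x ^ q ^ s = x}"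
  using q_gt_1 by (auto simp: is_subfield_def frob_add power_mult_distrib frob_minus power_inverse)

text \<open>
  The fixed elements are the roots of \<open>X ^ q ^ s - X\<close>, so they number at most \<open>q ^ s\<close>. They are
  also the kernel of the additive map \<open>x \<mapsto> x ^ q ^ s - x\<close>, so for the other bound it suffices
  that its image is small: the trace polynomial, of degree \<open>q ^ (n - s)\<close>, vanishes on it because the sum telescopes to
  \<open>x ^ q ^ n - x = 0\<close>.
\<close>
lemma card_fixed_field:
  assumes "s dvd n" "s > 0"
  shows "card {x :: 'a. x ^ q ^ s = x} = q ^ s"
proof -
  define P where "P = (monom 1 (q ^ s) - [:0, 1:] :: 'a poly)"
  have roots: "{x :: 'a. x ^ q ^ s = x} = {x. poly P x = 0}"
    by (auto simp: P_def poly_monom)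
  have qs: "q ^ s > 1" using q_gt_1 assms by (metis one_less_power)
  have degP: "degree P = q ^ s"
    using degree_add_eq_left[of "- [:0, 1:]" "monom (1 :: 'a) (q ^ s)"] qs
    by (simp add: P_def degree_monom_eq del: minus_pCons)
  have P0: "P \<noteq> 0" using degP qs by (metis degree_0 less_nat_zero_code)
  define r where "r = n div s"
  have n: "n = s * r" using assms by (simp add: r_def)
  define T where "T = (\<Sum>j<r. monom 1 (q ^ (s * j)) :: 'a poly)"
  have r0: "r > 0" using n n_pos by (cases r) auto
  have Tdeg: "degree T \<le> q ^ (s * (r - 1))"
    unfolding T_def
  proof (rule degree_sum_le)
    fix j assume "j \<in> {..<r}"
    then have "q ^ (s * j) \<le> q ^ (s * (r - 1))"
      using q_gt_1 by (intro power_increasing mult_le_mono) auto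
    then show "degree (monom (1::'a) (q ^ (s * j))) \<le> q ^ (s * (r - 1))"
      by (meson degree_monom_le le_trans)
  qed auto
  have "coeff T (q ^ (s * (r - 1))) = (\<Sum>j<r. if j = r - 1 then 1 else 0)"
    unfolding T_def coeff_sum using q_gt_1 assms r0 
    by (intro sum.cong) (auto simp: power_inject_exp)
  then have T0: "T \<noteq> 0" using r0 by auto
  have tele: "(\<Sum>j<k. (x ^ q ^ s - x) ^ q ^ (s * j)) = x ^ q ^ (s * k) - x" for x :: 'a and k
    by (induction k) (simp_all add: frob_diff frob_frob algebra_simps)
  have "(\<lambda>x. x ^ q ^ s - x) ` UNIV \<subseteq> {x :: 'a. poly T x = 0}"
    using tele[of _ r] frob_period[of _ 1] n by (auto simp: T_def poly_sum poly_monom)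
  then have "card ((\<lambda>x :: 'a. x ^ q ^ s - x) ` UNIV) \<le> card {x :: 'a. poly T x = 0}"
    by (intro card_mono) auto
  also have "\<dots> \<le> degree T" using card_poly_roots_bound[OF T0] by simp
  also note Tdeg
  finally have im: "card ((\<lambda>x :: 'a. x ^ q ^ s - x) ` UNIV) \<le> q ^ (s * (r - 1))" .
  have fib: "card {x :: 'a. x ^ q ^ s - x = z} \<le> card {x :: 'a. x ^ q ^ s = x}" for z
  proof (cases "\<exists>x0 :: 'a. x0 ^ q ^ s - x0 = z")
    case True
    then obtain x0 where x0: "x0 ^ q ^ s - x0 = z" by blast
    show ?thesis
    proof (rule card_inj_on_le[of "\<lambda>x. x - x0"])
      show "(\<lambda>x. x - x0) ` {x. x ^ q ^ s - x = z} \<subseteq> {x. x ^ q ^ s = x}"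
        using x0 by (auto simp: frob_diff algebra_simps)
    qed auto
  qed auto
  have "q ^ n = card (\<Union>z\<in>(\<lambda>x :: 'a. x ^ q ^ s - x) ` UNIV. {x :: 'a. x ^ q ^ s - x = z})"
    unfolding card_field[symmetric] by (intro arg_cong[where f = card]) auto
  also have "\<dots> \<le> (\<Sum>z\<in>(\<lambda>x :: 'a. x ^ q ^ s - x) ` UNIV. card {x :: 'a. x ^ q ^ s - x = z})"
    by (rule card_UN_le) simp
  also have "\<dots> \<le> card ((\<lambda>x :: 'a. x ^ q ^ s - x) ` UNIV) * card {x :: 'a. x ^ q ^ s = x}"
    using sum_bounded_above[of "(\<lambda>x :: 'a. x ^ q ^ s - x) ` UNIV" "\<lambda>z. card {x :: 'a. x ^ q ^ s - x = z}"] fib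
    by simp
  also have "\<dots> \<le> q ^ (s * (r - 1)) * card {x :: 'a. x ^ q ^ s = x}"
    using im by simp
  finally have "q ^ (s * (r - 1)) * q ^ s \<le> q ^ (s * (r - 1)) * card {x :: 'a. x ^ q ^ s = x}"
    using n r0 by (cases r) (auto simp: power_add mult_ac)
  then have "q ^ s \<le> card {x :: 'a. x ^ q ^ s = x}"
    using q_gt_1 by simp
  moreover have "card {x :: 'a. x ^ q ^ s = x} \<le> q ^ s"
    unfolding roots using card_poly_roots_bound[OF P0] degP by simp
  ultimately show ?thesis by simp
qed

section \<open>Annihilators of subspaces of the field\<close>

definition F_subspace :: "'a set \<Rightarrow> bool" where
  "F_subspace V \<longleftrightarrow> 0 \<in> V \<and> (\<forall>x\<in>V. \<forall>y\<in>V. x + y \<in> V) \<and> (\<forall>c\<in>F. \<forall>x\<in>V. c * x \<in> V)"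

text \<open>
  If a linearized polynomial \<open>P\<close> vanishes on a subspace \<open>V\<close>, then \<open>P ^ q - e P\<close> with
  \<open>e = P v ^ (q - 1)\<close> is linearized too and vanishes on \<open>V + F v\<close>.
\<close>
lemma linearized_step:
  assumes "c j = 1"
  obtains d where "d (Suc j) = 1"
    "\<And>x :: 'a. (\<Sum>i\<le>Suc j. d i * x ^ q ^ i) =
       (\<Sum>i\<le>j. c i * x ^ q ^ i) ^ q - e * (\<Sum>i\<le>j. c i * x ^ q ^ i)"
proof
  define d where "d i = (if i = 0 then 0 else c (i - 1) ^ q) - (if i \<le> j then e * c i else 0)" for i
  show "d (Suc j) = 1" using assms by (simp add: d_def)
  fix x :: 'a
  have "(\<Sum>i\<le>j. c i * x ^ q ^ i) ^ q = (\<Sum>i\<le>j. c i ^ q * x ^ q ^ Suc i)"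
    using frob_sum[of "\<lambda>i. c i * x ^ q ^ i" "{..j}" 1]
    by (simp add: power_mult_distrib mult.commute flip: power_mult)
  also have "\<dots> = (\<Sum>i\<le>Suc j. (if i = 0 then 0 else c (i - 1) ^ q) * x ^ q ^ i)"
    by (subst sum.atMost_Suc_shift) simp
  finally have 1: "(\<Sum>i\<le>j. c i * x ^ q ^ i) ^ q =
    (\<Sum>i\<le>Suc j. (if i = 0 then 0 else c (i - 1) ^ q) * x ^ q ^ i)" .
  have 2: "e * (\<Sum>i\<le>j. c i * x ^ q ^ i) = (\<Sum>i\<le>Suc j. (if i \<le> j then e * c i else 0) * x ^ q ^ i)"
    by (simp add: sum_distrib_left mult.assoc)
  show "(\<Sum>i\<le>Suc j. d i * x ^ q ^ i) =
       (\<Sum>i\<le>j. c i * x ^ q ^ i) ^ q - e * (\<Sum>i\<le>j. c i * x ^ q ^ i)"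
    unfolding 1 2 by (simp add: d_def left_diff_distrib sum_subtractf del: sum.atMost_Suc)
qed

text \<open>
  Built up one generator at a time, which doubles as the proof that the order of a subspace is a
  power of \<open>q\<close>: a largest subspace of \<open>V\<close> with the claimed properties cannot be proper.
\<close>
lemma F_subspace_annihilator:
  assumes "F_subspace V"
  obtains j c where "card V = q ^ j" "c j = 1" "\<And>v. v \<in> V \<Longrightarrow> (\<Sum>i\<le>j. c i * v ^ q ^ i) = 0"
proof -
  define good where "good V \<longleftrightarrow> (\<exists>j c. card V = q ^ j \<and> c j = 1 \<and>
    (\<forall>v\<in>V. (\<Sum>i\<le>j. c i * v ^ q ^ i) = 0))" for V :: "'a set"
  have F: "0 \<in> F" "1 \<in> F" "\<And>x y. x \<in> F \<Longrightarrow> y \<in> F \<Longrightarrow> x + y \<in> F \<and> x * y \<in> F" "\<And>x. x \<in> F \<Longrightarrow> - x \<in> F \<and> inverse x \<in> F"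
    using subfield_F by (auto simp: is_subfield_def)
  define S where "S = {V'. F_subspace V' \<and> V' \<subseteq> V \<and> good V'}"
  have "good {0}"
    unfolding good_def by (intro exI[of _ 0] exI[of _ "\<lambda>_. 1"]) auto
  then have "{0} \<in> S"
    using assms by (auto simp: S_def F_subspace_def)
  then have "Max (card ` S) \<in> card ` S"
    by (intro Max_in) auto
  then obtain W where W: "W \<in> S" "card W = Max (card ` S)"
    by auto
  have max: "card W' \<le> card W" if "W' \<in> S" for W'
    unfolding W(2) using that by (intro Max_ge) auto
  have "W = V"
  proof (rule ccontr)
    assume "W \<noteq> V"
    then obtain w where w: "w \<in> V" "w \<notin> W" using W by (auto simp: S_def)
    from W obtain j c where j: "card W = q ^ j" and c: "c j = 1" "\<And>v. v \<in> W \<Longrightarrow> (\<Sum>i\<le>j. c i * v ^ q ^ i) = 0"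
      by (auto simp: S_def good_def)
    have WF: "F_subspace W" using W by (simp add: S_def)
    define W' where "W' = (\<lambda>(a, x). a * w + x) ` (F \<times> W)"
    have inj: "inj_on (\<lambda>(a, x). a * w + x) (F \<times> W)"
    proof (rule inj_onI, clarify)
      fix a x a' x' assume *: "a \<in> F" "x \<in> W" "a' \<in> F" "x' \<in> W" "a * w + x = a' * w + x'"
      have "a = a'"
      proof (rule ccontr)
        assume "a \<noteq> a'"
        then have "w = inverse (a - a') * (x' + (-1) * x)"
          using *(5) by (simp add: field_simps)
        moreover have "inverse (a - a') \<in> F" "(-1) \<in> F"
          using F(1,2,4) F(3)[of a "-a'"] * by auto
        moreover have "(-1) * x \<in> W"
          using \<open>(-1) \<in> F\<close> WF * unfolding F_subspace_def by blast
        then have "x' + (-1) * x \<in> W"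
          using WF * unfolding F_subspace_def by blast
        ultimately show False using w(2) WF unfolding F_subspace_def by simp
      qed
      then show "a = a' \<and> x = x'" using * by simp
    qed
    have card': "card W' = q ^ Suc j"
      unfolding W'_def card_image[OF inj] by (simp add: card_cartesian_product card_F j)
    have F': "F_subspace W'"
      unfolding F_subspace_def
    proof (intro conjI ballI)
      show "0 \<in> W'"
        unfolding W'_def using F WF by (auto simp: F_subspace_def intro!: image_eqI[of _ _ "(0,0)"])
      fix x y assume "x \<in> W'" "y \<in> W'"
      then obtain a b u v where "a \<in> F" "b \<in> F" "u \<in> W" "v \<in> W" "x = a * w + u" "y = b * w + v"
        by (auto simp: W'_def)
      then show "x + y \<in> W'"
        unfolding W'_def using F WF
        by (auto simp: F_subspace_def algebra_simps intro!: image_eqI[of _ _ "(a+b, u+v)"])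
    next
      fix b x assume b: "b \<in> F" "x \<in> W'"
      then obtain a u where "a \<in> F" "u \<in> W" "x = a * w + u"
        by (auto simp: W'_def)
      then show "b * x \<in> W'"
        unfolding W'_def using F WF b
        by (auto simp: F_subspace_def algebra_simps intro!: image_eqI[of _ _ "(b * a, b * u)"])
    qed
    define P where "P x = (\<Sum>i\<le>j. c i * x ^ q ^ i)" for x
    obtain d where d: "d (Suc j) = 1" "\<And>x. (\<Sum>i\<le>Suc j. d i * x ^ q ^ i) = P x ^ q - P w ^ (q - 1) * P x"
      by (rule linearized_step[of c j "P w ^ (q - 1)"]) (use c in \<open>auto simp: P_def\<close>)
    have "(\<Sum>i\<le>Suc j. d i * v ^ q ^ i) = 0" if "v \<in> W'" for v
    proof -
      obtain a u where v: "a \<in> F" "u \<in> W" "v = a * w + u"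
        using \<open>v \<in> W'\<close> by (auto simp: W'_def)
      have "P v = a * P w + P u"
        by (simp add: P_def v frob_add power_mult_distrib frob_F[OF v(1)] sum_distrib_left sum.distrib algebra_simps)
      then have "P v = a * P w" using c v by (simp add: P_def)
      moreover have "a ^ q = a" using frob_F[OF v(1), of 1] by simp
      moreover have "P w ^ q = P w ^ (q - 1) * P w"
        using q_gt_1 by (cases q) auto
      ultimately show ?thesis unfolding d(2) by (simp add: power_mult_distrib)
    qed
    with d card' have "good W'" unfolding good_def by blast
    moreover have "W' \<subseteq> V"
      using W w assms by (auto simp: W'_def F_subspace_def S_def subset_iff)
    ultimately have "W' \<in> S" using F' by (simp add: S_def)
    then have "card W' \<le> card W" using max by blast
    then show False using card' j q_gt_1 by simp
  qed
  then have "good V" using W by (simp add: S_def)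
  then show ?thesis using that unfolding good_def by blast
qed

end

section \<open>A lower bound for the number of zeros in a pencil of functions\<close>

text \<open>
  A polynomial in \<open>y\<close> and \<open>X\<close> of total degree at most \<open>d\<close>, presented as a family of polynomials
  in \<open>X\<close> indexed by the values of \<open>y\<close>, so that it can be specialised and divided with remainder
  over the field.
\<close>
definition poly_family :: "nat \<Rightarrow> ('a::field \<Rightarrow> 'a poly) \<Rightarrow> bool" where
  "poly_family d g \<longleftrightarrow> (\<forall>i. \<exists>c. (\<forall>y. coeff (g y) i = poly c y) \<and> (c = 0 \<or> degree c + i \<le> d))"

lemma poly_familyE:
  assumes "poly_family d g"
  obtains c where "\<And>i y. coeff (g y) i = poly (c i) y" "\<And>i. c i = 0 \<or> degree (c i) + i \<le> d"
  using assms unfolding poly_family_def by metis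

lemma poly_family_const:
  assumes "degree p \<le> d"
  shows "poly_family d (\<lambda>_. p)"
  unfolding poly_family_def
proof
  fix i
  show "\<exists>c. (\<forall>y. coeff p i = poly c y) \<and> (c = 0 \<or> degree c + i \<le> d)"
    using assms le_degree[of p i] by (intro exI[of _ "[:coeff p i:]"]) (cases "coeff p i = 0"; auto)
qed

lemma poly_family_add:
  assumes "poly_family d f" "poly_family d g"
  shows "poly_family d (\<lambda>y. f y + g y)"
  unfolding poly_family_def
proof
  fix i
  obtain a b where ab: "\<forall>y. coeff (f y) i = poly a y" "a = 0 \<or> degree a + i \<le> d"
      "\<forall>y. coeff (g y) i = poly b y" "b = 0 \<or> degree b + i \<le> d"
    using assms unfolding poly_family_def by meson
  have "degree (a + b) \<le> max (degree a) (degree b)" by (rule degree_add_le_max)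
  then have "a + b = 0 \<or> degree (a + b) + i \<le> d" using ab by auto
  then show "\<exists>c. (\<forall>y. coeff (f y + g y) i = poly c y) \<and> (c = 0 \<or> degree c + i \<le> d)"
    using ab by (intro exI[of _ "a + b"]) auto
qed

lemma poly_family_sum:
  assumes "\<And>x. x \<in> A \<Longrightarrow> poly_family d (f x)"
  shows "poly_family d (\<lambda>y. \<Sum>x\<in>A. f x y)"
  using assms
  by (induction A rule: infinite_finite_induct) (auto intro: poly_family_add poly_family_const)

lemma poly_family_smult:
  assumes "poly_family d g" and "degree c \<le> e"
  shows "poly_family (e + d) (\<lambda>y. smult (poly c y) (g y))"
  unfolding poly_family_def
proof
  fix i
  obtain a where a: "\<forall>y. coeff (g y) i = poly a y" "a = 0 \<or> degree a + i \<le> d"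
    using assms unfolding poly_family_def by meson
  have "degree (c * a) \<le> degree c + degree a" by (rule degree_mult_le)
  then have "c * a = 0 \<or> degree (c * a) + i \<le> e + d" using a assms by auto
  then show "\<exists>c'. (\<forall>y. coeff (smult (poly c y) (g y)) i = poly c' y) \<and> (c' = 0 \<or> degree c' + i \<le> e + d)"
    using a by (intro exI[of _ "c * a"]) auto
qed

lemma poly_family_pCons:
  assumes "poly_family d g"
  shows "poly_family (Suc d) (\<lambda>y. pCons 0 (g y))"
  unfolding poly_family_def
proof
  fix i
  show "\<exists>c. (\<forall>y. coeff (pCons 0 (g y)) i = poly c y) \<and> (c = 0 \<or> degree c + i \<le> Suc d)"
  proof (cases i)
    case 0
    then show ?thesis by (intro exI[of _ 0]) auto
  next
    case (Suc j)
    obtain a where a: "\<forall>y. coeff (g y) j = poly a y" "a = 0 \<or> degree a + j \<le> d"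
      using assms unfolding poly_family_def by meson
    then show ?thesis using Suc by (intro exI[of _ a]) auto
  qed
qed

lemma poly_family_mult_linear:
  assumes "poly_family d g" and "degree c \<le> 1"
  shows "poly_family (Suc d) (\<lambda>y. [:- poly c y, 1:] * g y)"
proof -
  have *: "[:- poly c y, 1:] * g y = pCons 0 (g y) + smult (poly (- c) y) (g y)" for y
    by (simp add: algebra_simps)
  have "poly_family (1 + d) (\<lambda>y. smult (poly (- c) y) (g y))"
    using assms by (intro poly_family_smult) auto
  with poly_family_pCons[OF assms(1)] show ?thesis
    unfolding * by (intro poly_family_add) simp_all
qed

lemma poly_family_prod_linear:
  assumes "finite A" and "\<And>x. x \<in> A \<Longrightarrow> degree (c x) \<le> 1"
  shows "poly_family (card A) (\<lambda>y. \<Prod>x\<in>A. [:- poly (c x) y, 1:])"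
  using assms
proof (induction A rule: finite_induct)
  case empty
  then show ?case by (auto intro: poly_family_const)
next
  case (insert x A)
  then show ?case
    using poly_family_mult_linear[of "card A" "\<lambda>y. \<Prod>x\<in>A. [:- poly (c x) y, 1:]" "c x"] by auto
qed

text \<open>
  Division by a divisor that is monic in \<open>X\<close> does not raise the total degree: one reduction step
  replaces \<open>X\<^sup>d\<close> by \<open>X\<^sup>d - R\<close>, where \<open>R\<close> has total degree \<open>d\<close>.
\<close>
lemma poly_family_mod:
  fixes R :: "'a::field \<Rightarrow> 'a poly"
  assumes R: "poly_family d R" and monic: "\<And>y. degree (R y) = d \<and> lead_coeff (R y) = 1"
    and p: "degree p \<le> m"
  shows "poly_family m (\<lambda>y. p mod R y)"
proof -
  have R0: "R y \<noteq> 0" for y using monic[of y] by (metis leading_coeff_0_iff zero_neq_one)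
  have mon: "poly_family j (\<lambda>y. monom 1 j mod R y)" for j
  proof (cases "d = 0")
    case True
    then have "monom 1 j mod R y = 0" for y
      using monic[of y] R0[of y] by (metis dvd_imp_mod_0 is_unit_iff_degree unit_imp_dvd)
    then show ?thesis by (simp add: poly_family_const)
  next
    case d: False
    show ?thesis
    proof (induction j)
      case 0
      have "degree (1 :: 'a poly) < degree (R y)" for y using monic d by simp
      then have "monom 1 0 mod R y = 1" for y by (simp add: mod_poly_less)
      then show ?case by (simp add: poly_family_const)
    next
      case (Suc j)
      define g where "g y = monom 1 j mod R y" for y
      obtain c where c: "\<And>y. coeff (g y) (d - 1) = poly c y" "c = 0 \<or> degree c + (d - 1) \<le> j"
        using Suc unfolding g_def poly_family_def by meson
      have deg: "degree (g y) < d" for y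
        using degree_mod_less'[of "R y" "monom 1 j"] R0 monic d
        by (cases "g y = 0") (auto simp: g_def)
      have *: "monom 1 (Suc j) mod R y = pCons 0 (g y) + smult (poly (- c) y) (R y)" for y
      proof -
        define h where "h = pCons 0 (g y) + smult (poly (- c) y) (R y)"
        have "coeff h i = 0" if "i \<ge> d" for i
        proof (cases "i = d")
          case True
          then show ?thesis
            using d monic[of y] c by (cases d) (auto simp: h_def)
        next
          case False
          then have "i > d" using that by simp
          then show ?thesis
            using deg[of y] monic[of y] by (cases i) (auto simp: h_def coeff_eq_0)
        qed
        then have "degree h < d"
          by (metis d degree_0 gr_zeroI leading_coeff_0_iff not_le)
        then have "h mod R y = h" using monic[of y] by (simp add: mod_poly_less)
        moreover have "h mod R y = pCons 0 (g y) mod R y"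
          by (simp add: h_def poly_mod_add_left mod_smult_left del: poly_minus smult_minus_left)
        moreover have "pCons 0 (g y) mod R y = monom 1 (Suc j) mod R y"
        proof -
          have "[:0, 1:] * (monom 1 j mod R y) mod R y = [:0, 1:] * monom 1 j mod R y"
            by (rule mod_mult_right_eq)
          then show ?thesis by (simp add: g_def monom_Suc)
        qed
        ultimately show ?thesis by (simp add: h_def)
      qed
      have "poly_family (Suc j) (\<lambda>y. pCons 0 (g y))"
        using Suc unfolding g_def by (rule poly_family_pCons)
      moreover have "poly_family (Suc j) (\<lambda>y. smult (poly (- c) y) (R y))"
      proof (cases "c = 0")
        case True
        then show ?thesis by (simp add: poly_family_const)
      next
        case False
        then have "degree (- c) \<le> Suc j - d" "d \<le> Suc j" using c d by auto
        then show ?thesis using poly_family_smult[OF R, of "- c" "Suc j - d"] by simp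
      qed
      ultimately show ?case unfolding * by (rule poly_family_add)
    qed
  qed
  have *: "p mod R y = (\<Sum>i\<le>m. smult (poly [:coeff p i:] y) (monom 1 i mod R y))" for y
  proof -
    have "p = (\<Sum>i\<le>m. monom (coeff p i) i)" using poly_as_sum_of_monoms'[OF p] by simp
    also have "\<dots> = (\<Sum>i\<le>m. smult (coeff p i) (monom 1 i))" by (simp add: smult_monom)
    finally have "p mod R y = (\<Sum>i\<le>m. smult (coeff p i) (monom 1 i)) mod R y" by simp
    also have "\<dots> = (\<Sum>i\<le>m. smult (coeff p i) (monom 1 i mod R y))"
    proof -
      have "(\<Sum>i\<in>A. f i) mod R y = (\<Sum>i\<in>A. f i mod R y)" for f :: "nat \<Rightarrow> 'a poly" and A
        by (induction A rule: infinite_finite_induct) (simp_all add: poly_mod_add_left)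
      then show ?thesis by (simp add: mod_smult_left)
    qed
    finally show ?thesis by simp
  qed
  have "poly_family m (\<lambda>y. smult (poly [:coeff p i:] y) (monom 1 i mod R y))" if "i \<le> m" for i
  proof -
    have "poly_family (0 + i) (\<lambda>y. smult (poly [:coeff p i:] y) (monom 1 i mod R y))"
      by (rule poly_family_smult[OF mon]) simp
    then show ?thesis using that unfolding poly_family_def by fastforce
  qed
  then show ?thesis unfolding * by (intro poly_family_sum) simp
qed

lemma prod_linear_dvd:
  fixes p :: "'a::field poly"
  assumes "finite A" and "\<And>v. v \<in> A \<Longrightarrow> poly p v = 0"
  shows "(\<Prod>v\<in>A. [:- v, 1:]) dvd p"
  using assms
proof (induction A arbitrary: p rule: finite_induct)
  case (insert x A)
  then obtain r where r: "p = [:- x, 1:] * r"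
    by (metis dvdE insertI1 poly_eq_0_iff_dvd)
  have "poly r v = 0" if "v \<in> A" for v
    using insert.prems[of v] insert.hyps that r by auto
  then have "(\<Prod>v\<in>A. [:- v, 1:]) dvd r" by (rule insert.IH)
  then show ?case
    unfolding r prod.insert[OF insert.hyps] by (intro mult_dvd_mono dvd_refl)
qed auto

text \<open>
  Let \<open>R y\<close> be the product of the factors \<open>X - (b u - y a u)\<close> and \<open>P\<close> the product of all
  \<open>X - v\<close>. If \<open>u \<mapsto> b u - y a u\<close> is injective then \<open>R y\<close> divides \<open>P\<close>, so the remainder
  \<open>S y\<close> of \<open>P\<close> vanishes. At \<open>y0\<close> the divisor has a multiple root, so \<open>S y0\<close> is nonzero; it is
  divisible by the factors \<open>X - v\<close> with \<open>v\<close> in the image, so its degree \<open>i\<close> is at least the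
  size of the image. The coefficient of \<open>X\<^sup>i\<close> in \<open>S\<close> is then a nonzero polynomial in \<open>y\<close> of degree at
  most \<open>CARD('a) - i\<close> that vanishes at all injective values of \<open>y\<close>.
\<close>
lemma card_zero_values_ge:
  fixes a b :: "'b \<Rightarrow> 'a::{field, finite}"
  assumes U: "finite U" and noninj: "\<not> inj_on (\<lambda>u. b u - y0 * a u) U"
  shows "card ((\<lambda>u. b u - y0 * a u) ` U) \<le> card {y. \<not> inj_on (\<lambda>u. b u - y * a u) U}"
proof -
  define Q where "Q = CARD('a)"
  define R where "R y = (\<Prod>u\<in>U. [:- poly [:b u, - a u:] y, 1:])" for y
  define P where "P = (\<Prod>v\<in>(UNIV :: 'a set). [:- v, 1:])"
  define S where "S y = P mod R y" for y
  define V where "V = (\<lambda>u. b u - y0 * a u) ` U"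
  have R_eq: "R y = (\<Prod>u\<in>U. [:- (b u - y * a u), 1:])" for y
    by (simp add: R_def)
  have degP: "degree P = Q"
    unfolding P_def Q_def by (subst degree_prod_eq_sum_degree) auto
  have degR: "degree (R y) = card U" for y
    unfolding R_def by (subst degree_prod_eq_sum_degree) auto
  have lcR: "lead_coeff (R y) = 1" for y
    unfolding R_def lead_coeff_prod by simp
  have "poly_family (card U) R"
    unfolding R_def using U by (intro poly_family_prod_linear) auto
  then have "poly_family Q S"
    unfolding S_def using degP degR lcR by (intro poly_family_mod) auto
  then obtain c where c: "\<And>i y. coeff (S y) i = poly (c i) y"
      "\<And>i. c i = 0 \<or> degree (c i) + i \<le> Q"
    by (rule poly_familyE) blast
  have S0: "S y = 0" if "inj_on (\<lambda>u. b u - y * a u) U" for y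
  proof -
    have "R y = (\<Prod>v\<in>(\<lambda>u. b u - y * a u) ` U. [:- v, 1:])"
      unfolding R_eq prod.reindex[OF that] by simp
    also have "\<dots> dvd P"
      unfolding P_def by (rule prod_dvd_prod_subset) auto
    finally show ?thesis by (simp add: S_def)
  qed
  have "\<not> R y0 dvd P"
  proof
    assume dvd: "R y0 dvd P"
    obtain u u' where u: "u \<in> U" "u' \<in> U" "u \<noteq> u'" "b u - y0 * a u = b u' - y0 * a u'"
      using noninj by (auto simp: inj_on_def)
    define v where "v = b u - y0 * a u"
    define g where "g u = [:- (b u - y0 * a u), 1:]" for u
    have "prod g {u, u'} dvd R y0"
      unfolding R_eq g_def using u U by (intro prod_dvd_prod_subset) auto
    moreover have "prod g {u, u'} = g u * g u'" using u(3) by simp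
    moreover have "g u = [:- v, 1:]" "g u' = [:- v, 1:]"
      using u(4) by (auto simp: g_def v_def)
    ultimately have "[:- v, 1:] * [:- v, 1:] dvd P"
      using dvd by (metis dvd_trans)
    moreover have "P = [:- v, 1:] * (\<Prod>v\<in>UNIV - {v}. [:- v, 1:])"
      unfolding P_def by (subst prod.remove[of _ v]) auto
    ultimately have "[:- v, 1:] * [:- v, 1:] dvd [:- v, 1:] * (\<Prod>v\<in>UNIV - {v}. [:- v, 1:])"
      by (simp only:)
    then have "[:- v, 1:] dvd (\<Prod>v\<in>UNIV - {v}. [:- v, 1:])"
      by (subst (asm) dvd_mult_cancel_left) simp
    then have "poly (\<Prod>v\<in>UNIV - {v}. [:- v, 1:]) v = 0"
      by (simp add: poly_eq_0_iff_dvd)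
    then show False by (auto simp: poly_prod)
  qed
  then have S_y0: "S y0 \<noteq> 0" by (auto simp: S_def mod_eq_0_iff_dvd)
  have "(\<Prod>v\<in>V. [:- v, 1:]) dvd R y0"
  proof (rule prod_linear_dvd)
    fix v assume "v \<in> V"
    then obtain u where "u \<in> U" "v = b u - y0 * a u" by (auto simp: V_def)
    then show "poly (R y0) v = 0" unfolding R_eq poly_prod using U by (intro prod_zero bexI[of _ u]) auto
  qed (use U in \<open>simp add: V_def\<close>)
  moreover have "(\<Prod>v\<in>V. [:- v, 1:]) dvd P"
    unfolding P_def by (rule prod_dvd_prod_subset) auto
  ultimately have "(\<Prod>v\<in>V. [:- v, 1:]) dvd S y0"
    unfolding S_def by (rule dvd_mod[rotated])
  then have "degree (\<Prod>v\<in>V. [:- v, 1:]) \<le> degree (S y0)"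
    using S_y0 by (rule dvd_imp_degree_le)
  moreover have "degree (\<Prod>v\<in>V. [:- v, 1:]) = card V"
    by (subst degree_prod_eq_sum_degree) auto
  moreover define i where "i = degree (S y0)"
  ultimately have i: "card V \<le> i" by simp
  have "poly (c i) y0 \<noteq> 0"
    using S_y0 unfolding c(1)[symmetric] i_def leading_coeff_0_iff .
  then have ci: "c i \<noteq> 0" by auto
  have "{y. inj_on (\<lambda>u. b u - y * a u) U} \<subseteq> {y. poly (c i) y = 0}"
    using S0 c(1)[of _ i] by (metis (mono_tags, lifting) coeff_0 mem_Collect_eq subsetI)
  then have "card {y. inj_on (\<lambda>u. b u - y * a u) U} \<le> card {y. poly (c i) y = 0}"
    by (intro card_mono) auto
  also have "\<dots> \<le> degree (c i)" using card_poly_roots_bound[OF ci] by simp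
  finally have "card {y. inj_on (\<lambda>u. b u - y * a u) U} + card V \<le> Q"
    using c(2)[of i] ci i by linarith
  moreover have "Q = card {y. inj_on (\<lambda>u. b u - y * a u) U} + card {y. \<not> inj_on (\<lambda>u. b u - y * a u) U}"
    unfolding Q_def by (subst card_Un_disjoint[symmetric]) (auto intro: arg_cong[where f = card])
  ultimately show ?thesis by (simp add: V_def)
qed

section \<open>Linear dependence with independent parameters\<close>

lemma sum_powers_less:
  fixes q :: nat
  assumes "q > 1"
  shows "(\<Sum>i<m. q ^ i) < q ^ m"
proof (induction m)
  case (Suc m)
  then have "(\<Sum>i<Suc m. q ^ i) < 2 * q ^ m" by simp
  also have "\<dots> \<le> q ^ Suc m" using assms by simp
  finally show ?case .
qed auto

text \<open>
  Substituting \<open>z ^ q ^ i\<close> for the \<open>i\<close>-th variable loses no information on a multiaffine function: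
  distinct squarefree monomials turn into distinct powers of \<open>z\<close>, by uniqueness of expansions in
  base \<open>q\<close>.
\<close>
lemma multiaffine_poly:
  fixes G :: "(nat \<Rightarrow> 'a::field) \<Rightarrow> 'a" and q :: nat
  assumes q: "q > 1"
    and affine: "\<And>i y s. i < m \<Longrightarrow> G (y(i := s)) = G (y(i := 0)) + s * (G (y(i := 1)) - G (y(i := 0)))"
  shows "\<exists>p. degree p \<le> (\<Sum>i<m. q ^ i) \<and>
    (\<forall>z. poly p z = G (\<lambda>i. if i < m then z ^ q ^ i else u i)) \<and>
    (p = 0 \<longrightarrow> (\<forall>y. (\<forall>i\<ge>m. y i = u i) \<longrightarrow> G y = 0))"
  using affine
proof (induction m arbitrary: u)
  case 0
  have "y = u" if "\<forall>i. y i = u i" for y using that by auto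
  then show ?case by (intro exI[of _ "[:G u:]"]) auto
next
  case (Suc m)
  have "\<exists>p. degree p \<le> (\<Sum>i<m. q ^ i) \<and>
    (\<forall>z. poly p z = G (\<lambda>i. if i < m then z ^ q ^ i else (u(m := t)) i)) \<and>
    (p = 0 \<longrightarrow> (\<forall>y. (\<forall>i\<ge>m. y i = (u(m := t)) i) \<longrightarrow> G y = 0))" for t
    by (rule Suc.IH) (rule Suc.prems, simp)
  then obtain P where P: "\<And>t. degree (P t) \<le> (\<Sum>i<m. q ^ i)"
      "\<And>t z. poly (P t) z = G (\<lambda>i. if i < m then z ^ q ^ i else (u(m := t)) i)"
      "\<And>t y. P t = 0 \<Longrightarrow> (\<forall>i\<ge>m. y i = (u(m := t)) i) \<Longrightarrow> G y = 0"
    by metis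
  define d where "d = P 1 - P 0"
  define p where "p = P 0 + monom 1 (q ^ m) * d"
  have lt: "(\<Sum>i<m. q ^ i) < q ^ m" by (rule sum_powers_less[OF q])
  have degd: "degree d \<le> (\<Sum>i<m. q ^ i)"
    unfolding d_def by (intro degree_diff_le P)
  show ?case
  proof (intro exI[of _ p] conjI allI impI)
    have "degree (monom 1 (q ^ m) * d) \<le> q ^ m + (\<Sum>i<m. q ^ i)"
      by (rule order.trans[OF degree_mult_le add_mono[OF degree_monom_le degd]])
    moreover have "degree (P 0) \<le> q ^ m + (\<Sum>i<m. q ^ i)"
      by (rule trans_le_add2[OF P(1)])
    ultimately have "degree p \<le> q ^ m + (\<Sum>i<m. q ^ i)"
      unfolding p_def by (intro degree_add_le)
    then show "degree p \<le> (\<Sum>i<Suc m. q ^ i)" by simp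
  next
    fix z
    define g where "g = (\<lambda>i. if i < m then z ^ q ^ i else u i)"
    have upd: "(\<lambda>i. if i < m then z ^ q ^ i else (u(m := t)) i) = g(m := t)" for t
      by (auto simp: g_def)
    have "(\<lambda>i. if i < Suc m then z ^ q ^ i else u i) = g(m := z ^ q ^ m)"
      by (auto simp: g_def less_Suc_eq)
    moreover have "poly p z = G (g(m := 0)) + z ^ q ^ m * (G (g(m := 1)) - G (g(m := 0)))"
      by (simp only: p_def d_def poly_add poly_mult poly_monom poly_diff P(2) upd mult_1_left)
    moreover have "\<dots> = G (g(m := z ^ q ^ m))"
      by (rule Suc.prems[symmetric]) simp
    ultimately show "poly p z = G (\<lambda>i. if i < Suc m then z ^ q ^ i else u i)"
      by (simp only:)
  next
    fix y assume p0: "p = 0" and y: "\<forall>i\<ge>Suc m. y i = u i"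
    have "d = 0"
    proof (rule ccontr)
      assume "d \<noteq> 0"
      then have "degree (monom 1 (q ^ m) * d) = q ^ m + degree d"
        by (subst degree_mult_eq) (auto simp: degree_monom_eq)
      moreover have "P 0 = - (monom 1 (q ^ m) * d)"
        using p0 by (simp add: p_def eq_neg_iff_add_eq_0)
      ultimately have "degree (P 0) \<ge> q ^ m" by simp
      then show False using P(1)[of 0] lt by simp
    qed
    then have "P 0 = 0" "P 1 = 0" using p0 by (auto simp: p_def d_def)
    then have "G (y(m := 0)) = 0" "G (y(m := 1)) = 0"
      using P(3)[of 0 "y(m := 0)"] P(3)[of 1 "y(m := 1)"] y by auto
    moreover have "G (y(m := y m)) = G (y(m := 0)) + y m * (G (y(m := 1)) - G (y(m := 0)))"
      by (rule Suc.prems) simp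
    ultimately show "G y = 0"
      by (simp only: fun_upd_triv) simp
  qed
qed

definition indep_family :: "nat \<Rightarrow> (nat \<Rightarrow> 'a::field ^ 'x) \<Rightarrow> bool" where
  "indep_family N v \<longleftrightarrow> (\<forall>c. (\<Sum>i<N. c i *s v i) = 0 \<longrightarrow> (\<forall>i<N. c i = 0))"

lemma indep_family_iff:
  fixes v :: "nat \<Rightarrow> 'a::field ^ 'x"
  shows "indep_family N v \<longleftrightarrow> inj_on v {..<N} \<and> vec.independent (v ` {..<N})"
proof
  assume ind: "indep_family N v"
  have inj: "inj_on v {..<N}"
  proof (rule inj_onI, rule ccontr)
    fix i j assume ij: "i \<in> {..<N}" "j \<in> {..<N}" "v i = v j" "i \<noteq> j"
    define c where "c k = (if k = i then 1 else if k = j then -1 else 0 :: 'a)" for k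
    have "(\<Sum>k<N. c k *s v k) = (\<Sum>k\<in>{i, j}. c k *s v k)"
      using ij by (intro sum.mono_neutral_right) (auto simp: c_def)
    also have "\<dots> = 0" using ij by (simp add: c_def)
    finally have "c i = 0" using ind ij unfolding indep_family_def by blast
    then show False by (simp add: c_def)
  qed
  moreover have "vec.independent (v ` {..<N})"
    unfolding vec.independent_explicit
  proof (intro conjI allI impI ballI)
    fix u w assume u: "(\<Sum>w\<in>v ` {..<N}. u w *s w) = 0" and w: "w \<in> v ` {..<N}"
    have "(\<Sum>i<N. u (v i) *s v i) = 0"
      using u by (simp add: sum.reindex[OF inj])
    then show "u w = 0" using ind w unfolding indep_family_def
      by (auto dest!: spec[of _ "\<lambda>i. u (v i)"])
  qed auto
  ultimately show "inj_on v {..<N} \<and> vec.independent (v ` {..<N})" ..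
next
  assume "inj_on v {..<N} \<and> vec.independent (v ` {..<N})"
  then have inj: "inj_on v {..<N}" and ind: "vec.independent (v ` {..<N})" by auto
  show "indep_family N v"
    unfolding indep_family_def
  proof (intro allI impI)
    fix c i assume c: "(\<Sum>i<N. c i *s v i) = 0" and i: "i < N"
    define u where "u w = c (the_inv_into {..<N} v w)" for w
    have u: "u (v j) = c j" if "j < N" for j
      using that by (simp add: u_def the_inv_into_f_f[OF inj])
    have "(\<Sum>w\<in>v ` {..<N}. u w *s w) = 0"
      using c by (simp add: sum.reindex[OF inj] u)
    then have "u (v i) = 0"
      using ind i unfolding vec.independent_explicit by blast
    then show "c i = 0" using u i by simp
  qed
qed

text \<open>
  Completing the rows for the parameter \<open>t\<close> to a basis of the whole space turns dependence into
  the vanishing of a determinant \<open>G\<close> that is affine in each parameter and nonzero at \<open>t\<close>.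
\<close>
lemma card_dependent_values_le:
  fixes a b :: "nat \<Rightarrow> 'a::{field, finite} ^ 'x" and t :: "nat \<Rightarrow> 'a" and q m N :: nat
  defines "rw \<equiv> \<lambda>y i. if i < m then b i - y i *s a i else b i"
  assumes q: "q > 1" and ind: "indep_family N (rw t)" and mN: "m \<le> N"
  shows "card {z. \<not> indep_family N (rw (\<lambda>i. z ^ q ^ i))} \<le> (\<Sum>i<m. q ^ i)"
proof -
  define B where "B = vec.extend_basis (rw t ` {..<N})"
  have inj: "inj_on (rw t) {..<N}" and indB: "vec.independent B" and sub: "rw t ` {..<N} \<subseteq> B"
    and spanB: "vec.span B = UNIV"
    using ind vec.independent_extend_basis vec.extend_basis_superset vec.span_extend_basis
    unfolding indep_family_iff B_def by blast+
  have finB: "finite B" using indB by (rule vec.finiteI_independent)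
  have "card B = vec.dim B" using indB by (simp add: vec.dim_eq_card_independent)
  also have "\<dots> = vec.dim (UNIV :: ('a ^ 'x) set)" using spanB by (metis vec.dim_span)
  also have "\<dots> = CARD('x)" by (rule vec_dim_card)
  finally have "card (UNIV :: 'x set) = card B" by simp
  then obtain e where e: "bij_betw e (UNIV :: 'x set) B"
    using finite_same_card_bij[of "UNIV :: 'x set" B] finB by auto
  define pos where "pos i = the_inv_into UNIV e (rw t i)" for i
  have e_pos: "e (pos i) = rw t i" if "i < N" for i
    unfolding pos_def using e sub that
    by (intro f_the_inv_into_f_bij_betw[where B = B]) auto
  have pos_inj: "inj_on pos {..<N}"
    using inj e_pos by (metis inj_on_def lessThan_iff)
  define M where "M y = (\<chi> x. if x \<in> pos ` {..<N} then rw y (the_inv_into {..<N} pos x) else e x)" for y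
  have M_pos: "M y $ pos i = rw y i" if "i < N" for y i
    using that by (simp add: M_def the_inv_into_f_f[OF pos_inj])
  have M_other: "M y $ x = e x" if "x \<notin> pos ` {..<N}" for y x
    using that by (simp add: M_def)
  define G where "G y = det (M y)" for y
  have nonzero: "det A \<noteq> 0 \<longleftrightarrow> (\<forall>c. (\<Sum>x\<in>UNIV. c x *s (A $ x)) = 0 \<longrightarrow> (\<forall>x. c x = 0))" for A :: "'a ^ 'x ^ 'x"
    using matrix_right_invertible_independent_rows[of A]
    by (simp add: invertible_det_nz[symmetric] invertible_right_inverse row_def vec_lambda_eta)
  have Gt: "G t \<noteq> 0"
  proof -
    have Mt: "M t $ x = e x" for x
      using M_pos[of _ t] M_other[of x t] e_pos by (cases "x \<in> pos ` {..<N}") auto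
    show ?thesis
      unfolding G_def nonzero Mt
    proof (intro allI impI)
      fix c x assume c: "(\<Sum>x\<in>UNIV. c x *s e x) = 0"
      have einj: "inj e" and eB: "e ` UNIV = B" using e by (auto simp: bij_betw_def)
      have key: "u w = 0" if "(\<Sum>w\<in>B. u w *s w) = 0" "w \<in> B" for u w
        using indB that unfolding vec.independent_explicit by blast
      have "(\<Sum>w\<in>e ` UNIV. c (the_inv_into UNIV e w) *s w) = 0"
        using c by (simp add: sum.reindex[OF einj] the_inv_into_f_f[OF einj])
      then have "c (the_inv_into UNIV e (e x)) = 0"
        using key[of "\<lambda>w. c (the_inv_into UNIV e w)" "e x"] eB by auto
      then show "c x = 0" by (simp add: the_inv_into_f_f[OF einj])
    qed
  qed
  have G0: "G y = 0" if dep: "\<not> indep_family N (rw y)" for y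
  proof -
    obtain c i where c: "(\<Sum>i<N. c i *s rw y i) = 0" "i < N" "c i \<noteq> 0"
      using dep unfolding indep_family_def by blast
    define c' where "c' x = (if x \<in> pos ` {..<N} then c (the_inv_into {..<N} pos x) else 0)" for x
    have c': "c' (pos i) = c i" if "i < N" for i
      using that by (simp add: c'_def the_inv_into_f_f[OF pos_inj])
    have "(\<Sum>x\<in>UNIV. c' x *s (M y $ x)) = (\<Sum>x\<in>pos ` {..<N}. c' x *s (M y $ x))"
      by (rule sum.mono_neutral_right) (auto simp: c'_def)
    also have "\<dots> = 0"
      using c by (simp add: sum.reindex[OF pos_inj] c' M_pos)
    finally show ?thesis
      using nonzero[of "M y"] c' c unfolding G_def by metis
  qed
  have affine: "G (y(i := s)) = G (y(i := 0)) + s * (G (y(i := 1)) - G (y(i := 0)))" if i: "i < m" for y i s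
  proof -
    have iN: "i < N" using i mN by simp
    have M_upd: "M (y(i := s)) = (\<chi> x. if x = pos i then b i + (- s) *s a i else M y $ x)" for s
    proof (subst vec_eq_iff, rule allI)
      fix x
      consider "x = pos i" | j where "x = pos j" "j < N" "j \<noteq> i" | "x \<notin> pos ` {..<N}"
        using iN by (metis image_iff lessThan_iff)
      then show "M (y(i := s)) $ x = (\<chi> x. if x = pos i then b i + (- s) *s a i else M y $ x) $ x"
      proof cases
        case 1
        then show ?thesis using i by (simp add: M_pos[OF iN] rw_def)
      next
        case 2
        then have "x \<noteq> pos i" using pos_inj iN by (auto simp: inj_on_def)
        then show ?thesis using 2 by (simp add: M_pos rw_def)
      next
        case 3
        then have "x \<noteq> pos i" using iN by auto
        then show ?thesis using 3 by (simp add: M_other)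
      qed
    qed
    have eq: "G (y(i := s)) = det (\<chi> x. if x = pos i then b i else M y $ x)
        + (- s) * det (\<chi> x. if x = pos i then a i else M y $ x)" for s
      unfolding G_def M_upd det_row_add det_row_mul ..
    show ?thesis unfolding eq by (simp add: algebra_simps)
  qed
  obtain p where p: "degree p \<le> (\<Sum>i<m. q ^ i)"
      "\<And>z. poly p z = G (\<lambda>i. if i < m then z ^ q ^ i else t i)"
      "p = 0 \<Longrightarrow> \<forall>y. (\<forall>i\<ge>m. y i = t i) \<longrightarrow> G y = 0"
    using multiaffine_poly[of q m G t, OF q affine] by blast
  have p0: "p \<noteq> 0" using p(3) Gt by blast
  have "{z. \<not> indep_family N (rw (\<lambda>i. z ^ q ^ i))} \<subseteq> {z. poly p z = 0}"
  proof
    fix z assume "z \<in> {z. \<not> indep_family N (rw (\<lambda>i. z ^ q ^ i))}"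
    moreover have "rw (\<lambda>i. z ^ q ^ i) = rw (\<lambda>i. if i < m then z ^ q ^ i else t i)"
      by (auto simp: rw_def)
    ultimately show "z \<in> {z. poly p z = 0}" using p(2) G0 by simp
  qed
  then have "card {z. \<not> indep_family N (rw (\<lambda>i. z ^ q ^ i))} \<le> card {z. poly p z = 0}"
    by (intro card_mono) auto
  also have "\<dots> \<le> degree p" using card_poly_roots_bound[OF p0] by simp
  also note p(1)
  finally show ?thesis .
qed

section \<open>Independent transversals\<close>

lemma vec_dim_submodular:
  fixes A B C :: "('a::field ^ 'x) set"
  assumes "C \<subseteq> A" "C \<subseteq> B"
  shows "vec.dim (A \<union> B) + vec.dim C \<le> vec.dim A + vec.dim B"
proof -
  have "vec.dim (vec.span (A \<union> B)) + vec.dim (vec.span A \<inter> vec.span B) = vec.dim A + vec.dim B"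
    using vec.dim_sums_Int[of "vec.span A" "vec.span B"] by (simp add: vec.span_Un)
  moreover have "vec.dim C \<le> vec.dim (vec.span A \<inter> vec.span B)"
    using assms by (intro vec.dim_subset) (auto intro: vec.span_base)
  ultimately show ?thesis by simp
qed

text \<open>
  Rado's theorem on independent transversals. As long as some \<open>S i\<close> has two elements \<open>x\<close> and
  \<open>y\<close>, one of them can be removed: violations of the condition after removing \<open>x\<close> and after
  removing \<open>y\<close> would contradict submodularity of the dimension.
\<close>
lemma rado:
  fixes S :: "'i \<Rightarrow> ('a::field ^ 'x) set"
  assumes "finite I" and "\<And>i. i \<in> I \<Longrightarrow> finite (S i)"
    and "\<And>J. J \<subseteq> I \<Longrightarrow> card J \<le> vec.dim (\<Union>j\<in>J. S j)"
  shows "\<exists>v. (\<forall>i\<in>I. v i \<in> S i) \<and> card I \<le> vec.dim (v ` I)"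
  using assms
proof (induction "\<Sum>i\<in>I. card (S i)" arbitrary: S rule: less_induct)
  case less
  have ne: "S i \<noteq> {}" if "i \<in> I" for i
    using less.prems(3)[of "{i}"] that by auto
  show ?case
  proof (cases "\<exists>i\<in>I. \<exists>x\<in>S i. \<exists>y\<in>S i. x \<noteq> y")
    case False
    define v where "v i = (SOME x. x \<in> S i)" for i
    have "v i \<in> S i" if "i \<in> I" for i
      unfolding v_def using ne[OF that] by (meson all_not_in_conv someI_ex)
    then have v: "S i = {v i}" if "i \<in> I" for i
      using False that by blast
    then have "(\<Union>i\<in>I. S i) = v ` I" by auto
    then show ?thesis using less.prems(3)[of I] v by (intro exI[of _ v]) auto
  next
    case True
    then obtain i x y where i: "i \<in> I" and xy: "x \<in> S i" "y \<in> S i" "x \<noteq> y" by blast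
    define S' where "S' w = S(i := S i - {w})" for w
    have smaller: "(\<Sum>j\<in>I. card (S' w j)) < (\<Sum>j\<in>I. card (S j))" if "w \<in> S i" for w
    proof (rule sum_strict_mono_ex1)
      show "\<forall>j\<in>I. card (S' w j) \<le> card (S j)"
        using less.prems by (auto simp: S'_def intro: card_mono)
      show "\<exists>j\<in>I. card (S' w j) < card (S j)"
        using i card_Diff1_less[of "S i" w] that less.prems by (intro bexI[of _ i]) (auto simp: S'_def)
    qed (rule less.prems)
    have choice: ?thesis if "w \<in> S i" "\<And>J. J \<subseteq> I \<Longrightarrow> card J \<le> vec.dim (\<Union>j\<in>J. S' w j)" for w
    proof -
      have "\<exists>v. (\<forall>j\<in>I. v j \<in> S' w j) \<and> card I \<le> vec.dim (v ` I)"
        using that less.prems by (intro less.hyps smaller) (auto simp: S'_def)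
      moreover have "S' w j \<subseteq> S j" for j by (auto simp: S'_def)
      ultimately show ?thesis by blast
    qed
    show ?thesis
    proof (rule ccontr)
      assume "\<not> ?thesis"
      then obtain J K where J: "J \<subseteq> I" "vec.dim (\<Union>j\<in>J. S' x j) < card J"
          and K: "K \<subseteq> I" "vec.dim (\<Union>j\<in>K. S' y j) < card K"
        using choice[of x] choice[of y] xy by (metis not_le)
      have fin: "finite J" "finite K" using J K less.prems(1) finite_subset by blast+
      have "i \<in> J"
      proof (rule ccontr)
        assume "i \<notin> J"
        then have "(\<Union>j\<in>J. S' x j) = (\<Union>j\<in>J. S j)" by (auto simp: S'_def)
        then show False using J less.prems(3)[of J] by simp
      qed
      have "i \<in> K"
      proof (rule ccontr)
        assume "i \<notin> K"
        then have "(\<Union>j\<in>K. S' y j) = (\<Union>j\<in>K. S j)" by (auto simp: S'_def)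
        then show False using K less.prems(3)[of K] by simp
      qed
      define A where "A = (\<Union>j\<in>J. S' x j)"
      define B where "B = (\<Union>j\<in>K. S' y j)"
      have "(\<Union>j\<in>J \<union> K. S j) \<subseteq> A \<union> B"
      proof
        fix z assume "z \<in> (\<Union>j\<in>J \<union> K. S j)"
        then obtain j where j: "j \<in> J \<union> K" "z \<in> S j" by blast
        show "z \<in> A \<union> B"
          using j \<open>i \<in> J\<close> \<open>i \<in> K\<close> xy by (cases "j = i"; cases "z = x") (auto simp: A_def B_def S'_def)
      qed
      then have "card (J \<union> K) \<le> vec.dim (A \<union> B)"
        using less.prems(3)[of "J \<union> K"] J K vec.dim_subset by (meson Un_least le_trans)
      moreover have "card (J \<inter> K - {i}) \<le> vec.dim (\<Union>j\<in>J \<inter> K - {i}. S j)"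
        using less.prems(3)[of "J \<inter> K - {i}"] J by blast
      moreover have "vec.dim (A \<union> B) + vec.dim (\<Union>j\<in>J \<inter> K - {i}. S j) \<le> vec.dim A + vec.dim B"
        by (rule vec_dim_submodular) (auto simp: A_def B_def S'_def)
      moreover have "card (J \<union> K) + card (J \<inter> K) = card J + card K"
        using fin by (rule card_Un_Int[symmetric])
      moreover have "card (J \<inter> K) = Suc (card (J \<inter> K - {i}))"
        using \<open>i \<in> J\<close> \<open>i \<in> K\<close> fin by (metis IntI card.remove finite_Int)
      ultimately show False using J(2) K(2) unfolding A_def[symmetric] B_def[symmetric] by linarith
    qed
  qed
qed

lemma indep_family_if_dim:
  fixes v :: "nat \<Rightarrow> 'a::field ^ 'x"
  assumes "N \<le> vec.dim (v ` {..<N})"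
  shows "indep_family N v"
proof -
  have le: "vec.dim (v ` {..<N}) \<le> card (v ` {..<N})"
    by (rule vec.dim_le_card) (auto intro: vec.span_base)
  have "card (v ` {..<N}) \<le> N"
    using card_image_le[of "{..<N}" v] by simp
  with assms le have "card (v ` {..<N}) = card {..<N}" and dim: "card (v ` {..<N}) \<le> vec.dim (v ` {..<N})"
    by simp_all
  then have "inj_on v {..<N}" by (intro eq_card_imp_inj_on) auto
  moreover have "vec.independent (v ` {..<N})"
    using dim by (intro vec.card_le_dim_spanning[where V = "v ` {..<N}"]) (auto intro: vec.span_base)
  ultimately show ?thesis by (simp add: indep_family_iff)
qed

section \<open>Translates of a minimal tight set\<close>

text \<open>
  Here \<open>Z\<close> is tight (its dimension does not exceed its size) and minimal with that property. Take
  the union of the translates of \<open>Z\<close> by the elements of the numerical semigroup \<open>H\<close> generated by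
  \<open>Z\<close>, in increasing order. The translate by \<open>j > 0\<close> in \<open>H\<close> meets the previous union, because
  \<open>j = h + z\<close> with \<open>h\<close> in \<open>H\<close> and \<open>z\<close> in \<open>Z\<close>, and it is not contained in it, because its largest
  element is new. By minimality the intersection is not tight, so by submodularity the dimension
  grows by less than the number of new elements. After all translates up to \<open>N\<close> the dimension is
  therefore at most \<open>|X| - |J| + 1\<close>, and \<open>X - J\<close> lies among the multiples of \<open>s\<close> in an
  interval of length \<open>Max Z\<close>.

  By periodicity only residues modulo \<open>n\<close> matter, and the residues of \<open>H\<close> form a subgroup; \<open>s\<close> is
  its generator.
\<close>
lemma dim_multiples_le:
  fixes T :: "nat \<Rightarrow> ('a::field ^ 'x) set"
  defines "D \<equiv> \<lambda>X. vec.dim (\<Union>i\<in>X. T i)"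
  assumes shift: "\<And>X j. D ((+) j ` X) = D X"
    and n: "n > 0" and period: "\<And>i. T (i + n) = T i"
    and Z: "finite Z" "0 \<in> Z" and tight: "D Z \<le> card Z"
    and atom: "\<And>Y. Y \<subset> Z \<Longrightarrow> Y \<noteq> {} \<Longrightarrow> card Y < D Y"
  shows "\<exists>s>0. s dvd n \<and> s dvd Max Z \<and> D {i. s dvd i} \<le> Max Z div s + 1"
proof -
  define m where "m = Max Z"
  have mZ: "m \<in> Z" and Zm: "\<And>z. z \<in> Z \<Longrightarrow> z \<le> m"
    using Z unfolding m_def by (auto intro: Max_in)
  define H where "H = \<Inter>{H. 0 \<in> H \<and> (\<forall>h\<in>H. \<forall>z\<in>Z. h + z \<in> H)}"
  have H0: "0 \<in> H" and Hadd: "\<And>h z. h \<in> H \<Longrightarrow> z \<in> Z \<Longrightarrow> h + z \<in> H"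
    by (auto simp: H_def)
  have H_induct: "P h" if "h \<in> H" "P 0" "\<And>h z. h \<in> H \<Longrightarrow> P h \<Longrightarrow> z \<in> Z \<Longrightarrow> P (h + z)" for P h
  proof -
    have "h \<in> {h \<in> H. P h}"
      using that(1) unfolding H_def by (rule InterD) (use H0 Hadd that in \<open>auto simp: H_def[symmetric]\<close>)
    then show ?thesis by simp
  qed
  have H_closed: "h + h' \<in> H" if "h \<in> H" "h' \<in> H" for h h'
    using \<open>h' \<in> H\<close> by (rule H_induct) (use \<open>h \<in> H\<close> Hadd in \<open>auto simp: add.assoc[symmetric]\<close>)
  have H_pred: "\<exists>h'\<in>H. \<exists>z\<in>Z. z > 0 \<and> h = h' + z" if "h \<in> H" "h > 0" for h
  proof -
    have "h > 0 \<longrightarrow> (\<exists>h'\<in>H. \<exists>z\<in>Z. z > 0 \<and> h = h' + z)"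
      using \<open>h \<in> H\<close>
    proof (rule H_induct)
      fix h z assume *: "h \<in> H" "h > 0 \<longrightarrow> (\<exists>h'\<in>H. \<exists>z\<in>Z. z > 0 \<and> h = h' + z)" "z \<in> Z"
      then show "h + z > 0 \<longrightarrow> (\<exists>h'\<in>H. \<exists>z'\<in>Z. z' > 0 \<and> h + z = h' + z')"
        by (cases "z = 0") auto
    qed auto
    then show ?thesis using that by simp
  qed

  define J where "J N = H \<inter> {..N}" for N
  define X where "X N = (\<Union>j\<in>J N. (+) j ` Z)" for N
  have finJ: "finite (J N)" and finX: "finite (X N)" for N
    using Z by (auto simp: J_def X_def)
  have bound: "D (X N) + card (J N) \<le> card (X N) + 1" for N
  proof (induction N)
    case 0
    have "J 0 = {0}" using H0 by (auto simp: J_def)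
    moreover then have "X 0 = Z" by (auto simp: X_def)
    ultimately show ?case using tight by simp
  next
    case (Suc N)
    show ?case
    proof (cases "Suc N \<in> H")
      case False
      then have "J (Suc N) = J N" by (auto simp: J_def le_Suc_eq)
      then show ?thesis using Suc by (simp add: X_def)
    next
      case True
      define j where "j = Suc N"
      define A where "A = (+) j ` Z"
      have J_Suc: "J (Suc N) = insert j (J N)" using True by (auto simp: J_def le_Suc_eq j_def)
      have "j \<notin> J N" by (simp add: J_def j_def)
      then have cardJ: "card (J (Suc N)) = Suc (card (J N))" using J_Suc finJ by simp
      have X_Suc: "X (Suc N) = X N \<union> A" by (auto simp: X_def J_Suc A_def)
      have cardA: "card A = card Z" unfolding A_def by (rule card_image) simp
      have finA: "finite A" using Z by (simp add: A_def)
      have "j + m \<notin> X N"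
        using Zm by (fastforce simp: X_def J_def j_def)
      obtain h z where hz: "h \<in> H" "z \<in> Z" "z > 0" "j = h + z"
        using H_pred[of j] True by (auto simp: j_def)
      have "h \<in> J N" using hz by (auto simp: J_def j_def)
      then have jX: "j \<in> X N" using hz by (auto simp: X_def)
      define Y where "Y = {z \<in> Z. j + z \<in> X N}"
      have Y: "Y \<subset> Z" "Y \<noteq> {}"
        using \<open>j + m \<notin> X N\<close> mZ jX Z by (auto simp: Y_def)
      have YA: "(+) j ` Y = X N \<inter> A" by (auto simp: Y_def A_def)
      have "card Y < D (X N \<inter> A)"
        using atom[OF Y] shift[of j Y] YA by simp
      moreover have "card Y = card (X N \<inter> A)"
        unfolding YA[symmetric] by (rule card_image[symmetric]) simp
      moreover have "D (X (Suc N)) + D (X N \<inter> A) \<le> D (X N) + D A"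
        unfolding D_def X_Suc UN_Un by (rule vec_dim_submodular) auto
      moreover have "D A \<le> card Z" using tight shift[of j Z] by (simp add: A_def)
      moreover have "card (X N) + card A = card (X (Suc N)) + card (X N \<inter> A)"
        unfolding X_Suc by (rule card_Un_Int[OF finX finA])
      ultimately show ?thesis using Suc cardJ cardA by linarith
    qed
  qed

  \<comment> \<open>the residues of \<open>H\<close> modulo \<open>n\<close> form a subgroup\<close>
  define G where "G = {g. \<exists>h\<in>H. h mod n = g mod n}"
  have HG: "H \<subseteq> G" by (auto simp: G_def)
  have nG: "n \<in> G" using H0 by (auto simp: G_def intro!: bexI[of _ 0])
  have G_add: "g + g' \<in> G" if g: "g \<in> G" "g' \<in> G" for g g'
  proof -
    obtain h h' where "h \<in> H" "h' \<in> H" "h mod n = g mod n" "h' mod n = g' mod n"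
      using g unfolding G_def by auto
    then have "h + h' \<in> H" "(h + h') mod n = (g + g') mod n"
      using H_closed by (auto intro: mod_add_cong)
    then show ?thesis unfolding G_def by auto
  qed
  have G_mult: "k * g \<in> G" if "g \<in> G" for k g
    using that by (induction k) (use H0 G_add HG in auto)
  have G_diff: "g' \<in> G" if "g + g' \<in> G" "g \<in> G" for g g'
  proof -
    have "(g + g') + (n - 1) * g \<in> G"
      using that G_add G_mult by blast
    moreover have "(g + g') + (n - 1) * g = g' + n * g"
      using n by (cases n) auto
    ultimately have "g' + n * g \<in> G" by (simp only:)
    then show ?thesis by (simp add: G_def)
  qed
  define s where "s = (LEAST g. g \<in> G \<and> g > 0)"
  have s: "s \<in> G" "s > 0" and s_least: "\<And>g. g \<in> G \<Longrightarrow> g > 0 \<Longrightarrow> s \<le> g"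
    using LeastI[of "\<lambda>g. g \<in> G \<and> g > 0" n] nG n Least_le[of "\<lambda>g. g \<in> G \<and> g > 0"]
    unfolding s_def by auto
  have s_dvd: "s dvd g" if "g \<in> G" for g
  proof -
    have "g mod s \<in> G"
      using G_diff[of "g div s * s" "g mod s"] G_mult[OF s(1)] that by simp
    then have "g mod s = 0"
      using s_least[of "g mod s"] s(2) by (meson mod_less_divisor not_gr_zero not_le)
    then show ?thesis by (simp add: mod_eq_0_iff_dvd)
  qed
  have "Z \<subseteq> H" using Hadd[OF H0] by auto
  then have s_m: "s dvd m" using s_dvd HG mZ by blast
  have dim_X: "D (X N) \<le> m div s + 1" for N
  proof -
    have "X N \<subseteq> J N \<union> (H \<inter> {N<..N + m})"
      using Hadd Zm by (force simp: X_def J_def)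
    moreover have "H \<inter> {N<..N + m} \<subseteq> {i. s dvd i} \<inter> {N<..N + m}"
      using s_dvd HG by blast
    ultimately have "card (X N) \<le> card (J N \<union> ({i. s dvd i} \<inter> {N<..N + m}))"
      by (intro card_mono) (auto simp: finJ)
    also have "\<dots> \<le> card (J N) + card ({i. s dvd i} \<inter> {N<..N + m})"
      by (rule card_Un_le)
    also have "card ({i. s dvd i} \<inter> {N<..N + m}) \<le> card {N div s<..(N + m) div s}"
    proof (rule card_inj_on_le[of "\<lambda>i. i div s"])
      show "inj_on (\<lambda>i. i div s) ({i. s dvd i} \<inter> {N<..N + m})"
        by (rule inj_onI) (metis Int_iff dvd_div_eq_cancel mem_Collect_eq)
      show "(\<lambda>i. i div s) ` ({i. s dvd i} \<inter> {N<..N + m}) \<subseteq> {N div s<..(N + m) div s}"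
      proof (rule image_subsetI)
        fix i assume i: "i \<in> {i. s dvd i} \<inter> {N<..N + m}"
        then have "i div s \<le> (N + m) div s" by (intro div_le_mono) auto
        moreover have "N < i div s * s" using i by auto
        then have "N div s < i div s"
          using s(2) by (simp add: less_mult_imp_div_less)
        ultimately show "i div s \<in> {N div s<..(N + m) div s}" by simp
      qed
    qed simp
    also have "card {N div s<..(N + m) div s} = m div s"
      using s_m s(2) by (auto elim!: dvdE)
    finally show ?thesis using bound[of N] by simp
  qed
  have Tmod: "T i = T (i mod n)" for i
  proof -
    have "T (i + k * n) = T i" for i k
      by (induction k arbitrary: i) (simp_all add: period add.assoc[symmetric] add.commute[of n])
    from this[of "i mod n" "i div n"] show ?thesis by simp
  qed
  have "range T \<subseteq> T ` {..<n}"
    using Tmod n by (metis image_eqI image_subsetI lessThan_iff mod_less_divisor)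
  then have "finite (T ` H)" by (meson finite_imageI finite_lessThan finite_subset subset_UNIV image_mono)
  then obtain H' where H': "H' \<subseteq> H" "finite H'" "T ` H = T ` H'"
    by (metis finite_subset_image subset_refl)
  define N where "N = Max (insert 0 H')"
  have "H' \<subseteq> J N" using H' by (auto simp: J_def N_def)
  moreover have "J N \<subseteq> X N" using Z by (force simp: X_def)
  ultimately have "H' \<subseteq> X N" by blast
  have "(\<Union>i\<in>{i. s dvd i}. T i) \<subseteq> (\<Union>i\<in>X N. T i)"
  proof (rule UN_least)
    fix i assume "i \<in> {i. s dvd i}"
    then have "i \<in> G" using G_mult[OF s(1)] by (auto elim!: dvdE simp: mult.commute)
    then obtain h where "h \<in> H" "h mod n = i mod n" by (auto simp: G_def)
    then have "T i \<in> T ` H" using Tmod by (metis image_eqI)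
    then show "T i \<subseteq> (\<Union>i\<in>X N. T i)" using H' \<open>H' \<subseteq> X N\<close> by auto
  qed
  then have "D {i. s dvd i} \<le> D (X N)"
    unfolding D_def by (rule vec.dim_subset)
  then show ?thesis
    using dim_X[of N] s s_dvd[OF nG] s_m unfolding m_def[symmetric] by (meson le_trans)
qed

section \<open>Frobenius powers of functions as vectors\<close>

lemma span_image_coeffs:
  fixes f :: "nat \<Rightarrow> 'a::field ^ 'x"
  assumes "x \<in> vec.span (f ` I)" and "finite I"
  shows "\<exists>c. x = (\<Sum>i\<in>I. c i *s f i)"
  using assms(1)
proof (induction rule: vec.span_induct_alt)
  case base
  show ?case by (intro exI[of _ "\<lambda>_. 0"]) simp
next
  case (step c x y)
  then obtain i d where i: "i \<in> I" "x = f i" and d: "y = (\<Sum>i\<in>I. d i *s f i)" by auto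
  have "(\<Sum>j\<in>I. (d j + (if j = i then c else 0)) *s f j) = y + (\<Sum>j\<in>I. (if j = i then c *s f j else 0))"
    unfolding d sum.distrib[symmetric] by (intro sum.cong) (auto simp: vec.scale_left_distrib)
  also have "\<dots> = c *s x + y" using i assms(2) by (simp add: sum.delta)
  finally show ?case by metis
qed

context frobenius_field
begin

definition frob_vec :: "nat \<Rightarrow> 'a ^ 'x \<Rightarrow> 'a ^ 'x" where
  "frob_vec j x = (\<chi> i. x $ i ^ q ^ j)"

lemma dim_frob_vec: "vec.dim (frob_vec j ` X) = vec.dim X"
proof -
  have le: "vec.dim (frob_vec j ` X) \<le> vec.dim X" for X :: "('a ^ 'x) set" and j
  proof -
    obtain B where B: "B \<subseteq> X" "vec.independent B" "X \<subseteq> vec.span B" "card B = vec.dim X"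
      using vec.basis_exists by blast
    have finB: "finite B" using B(2) by (rule vec.finiteI_independent)
    have "frob_vec j x \<in> vec.span (frob_vec j ` B)" if "x \<in> vec.span B" for x
      using that
    proof (induction rule: vec.span_induct_alt)
      case base
      have "frob_vec j 0 = (0 :: 'a ^ 'x)" by (simp add: frob_vec_def vec_eq_iff)
      then show ?case by (simp add: vec.span_zero)
    next
      case (step c x y)
      have "frob_vec j (c *s x + y) = c ^ q ^ j *s frob_vec j x + frob_vec j y"
        by (simp add: frob_vec_def vec_eq_iff frob_add power_mult_distrib)
      then show ?case
        using step by (metis imageI vec.span_add vec.span_base vec.span_scale)
    qed
    then have "frob_vec j ` X \<subseteq> vec.span (frob_vec j ` B)" using B by blast
    then have "vec.dim (frob_vec j ` X) \<le> card (frob_vec j ` B)"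
      using finB by (intro vec.dim_le_card) auto
    also have "\<dots> \<le> card B" using finB by (rule card_image_le)
    finally show ?thesis using B by simp
  qed
  have "j + (n - 1) * j = n * j" using n_pos by (cases n) auto
  then have inv: "frob_vec ((n - 1) * j) (frob_vec j x) = x" for x :: "'a ^ 'x"
    by (simp add: frob_vec_def vec_eq_iff frob_frob frob_period)
  have "X = frob_vec ((n - 1) * j) ` frob_vec j ` X"
    unfolding image_image inv by simp
  then have "vec.dim X = vec.dim (frob_vec ((n - 1) * j) ` frob_vec j ` X)"
    by (rule arg_cong)
  also have "\<dots> \<le> vec.dim (frob_vec j ` X)" by (rule le)
  finally show ?thesis using le[of j X] by (rule antisym[rotated])
qed

lemma frob_vec_diff: "frob_vec j (x - y) = frob_vec j x - frob_vec j y"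
  by (simp add: frob_vec_def vec_eq_iff frob_diff)

text \<open>
  The function \<open>u \<mapsto> g u ^ q ^ i\<close> on \<open>U\<close> as a vector over the field, extended by zero outside \<open>U\<close>
  so that the vector space and dimension theory of the ambient type applies.
\<close>
definition pow_vec :: "'x set \<Rightarrow> ('x \<Rightarrow> 'a) \<Rightarrow> nat \<Rightarrow> 'a ^ 'x" where
  "pow_vec U g i = (\<chi> u. if u \<in> U then g u ^ q ^ i else 0)"

lemma pow_vec_nth: "u \<in> U \<Longrightarrow> pow_vec U g i $ u = g u ^ q ^ i"
  by (simp add: pow_vec_def)

lemma pow_vec_add: "pow_vec U g (j + i) = frob_vec j (pow_vec U g i)"
  by (simp add: pow_vec_def frob_vec_def vec_eq_iff frob_frob add.commute)

lemma pow_vec_period: "pow_vec U g (i + n) = pow_vec U g i"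
  using frob_add_period[of _ i 1] by (simp add: pow_vec_def vec_eq_iff)

text \<open>
  A relation is a polynomial of degree less than \<open>q ^ k\<close> with \<open>q ^ k\<close> roots.
\<close>
lemma pow_vec_indep:
  fixes U :: "'x::finite set"
  assumes inj: "inj_on g U" and card: "card U = q ^ k"
  shows "indep_family k (pow_vec U g)"
  unfolding indep_family_def
proof (intro allI impI)
  fix c i assume c: "(\<Sum>i<k. c i *s pow_vec U g i) = 0" and i: "i < k"
  define P where "P = (\<Sum>i<k. monom (c i) (q ^ i))"
  have root: "poly P (g u) = 0" if "u \<in> U" for u
  proof -
    have "(\<Sum>i<k. c i *s pow_vec U g i) $ u = 0" using c by simp
    then show ?thesis using that by (simp add: P_def poly_sum poly_monom pow_vec_nth)
  qed
  have "degree P \<le> q ^ (k - 1)"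
    unfolding P_def
  proof (rule degree_sum_le)
    fix j assume "j \<in> {..<k}"
    then have "q ^ j \<le> q ^ (k - 1)" using q_gt_1 by (intro power_increasing) auto
    then show "degree (monom (c j) (q ^ j)) \<le> q ^ (k - 1)" by (meson degree_monom_le le_trans)
  qed auto
  also have "\<dots> < q ^ k" using q_gt_1 i by (intro power_strict_increasing) auto
  finally have deg: "degree P < q ^ k" .
  have "P = 0"
  proof (rule ccontr)
    assume P0: "P \<noteq> 0"
    have "card (g ` U) \<le> card {x. poly P x = 0}"
      using root by (intro card_mono) auto
    also have "\<dots> \<le> degree P" using card_poly_roots_bound[OF P0] by simp
    finally show False using deg card_image[OF inj] card by simp
  qed
  then have "0 = coeff P (q ^ i)" by simp
  also have "\<dots> = (\<Sum>j<k. if j = i then c j else 0)"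
    unfolding P_def coeff_sum using q_gt_1 by (intro sum.cong) (auto simp: power_inject_exp)
  also have "\<dots> = c i" using i by (simp add: sum.delta)
  finally show "c i = 0" by simp
qed

lemma frob_fixed: "x ^ q ^ s = x \<Longrightarrow> (x :: 'a) ^ q ^ (s * i) = x"
proof (induction i)
  case (Suc i)
  have "x ^ q ^ (s * Suc i) = (x ^ q ^ s) ^ q ^ (s * i)" by (simp add: frob_frob)
  then show ?case using Suc by simp
qed auto

text \<open>
  For each of the values \<open>y\<close> in question the image of \<open>\<beta> - y \<alpha>\<close> is annihilated by a linearized
  polynomial of \<open>q\<close>-degree at most \<open>m\<close>. This is a linear relation between the vectors
  \<open>b i - y ^ q ^ i a i\<close> for \<open>i \<le> m\<close>, so those with \<open>i < m\<close> become dependent together with both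
  \<open>b m\<close> and \<open>b m - a m\<close>. As there are more such \<open>y\<close> than \<open>1 + q + \<dots> + q ^ (m - 1)\<close>, the dependence
  persists for arbitrary parameters in place of \<open>y ^ q ^ i\<close>. Parameters \<open>0\<close> and \<open>1\<close> select
  \<open>b i\<close> and \<open>b i - a i\<close>, so these pairs have no independent transversal containing both vectors of
  the pair \<open>m\<close>, and Rado's theorem yields a tight set.
\<close>
lemma exists_tight_set:
  fixes U :: "'x::finite set" and \<alpha> \<beta> :: "'x \<Rightarrow> 'a"
  defines "a \<equiv> pow_vec U \<alpha>" and "b \<equiv> pow_vec U \<beta>"
  assumes sub: "\<And>y. F_subspace ((\<lambda>u. \<beta> u - y * \<alpha> u) ` U)"
    and many: "q ^ m \<le> card {y. card ((\<lambda>u. \<beta> u - y * \<alpha> u) ` U) \<le> q ^ m}"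
  shows "\<exists>Z. Z \<subseteq> {..m} \<and> Z \<noteq> {} \<and> vec.dim (\<Union>i\<in>Z. {b i, b i - a i}) \<le> card Z"
proof -
  define T where "T i = {b i, b i - a i}" for i
  define b' where "b' i = (if i \<le> m then b i else b m - a m)" for i
  define rw where "rw y i = (if i < m then b' i - y i *s a i else b' i)" for y :: "nat \<Rightarrow> 'a" and i
  have dep: "\<not> indep_family (m + 2) (rw (\<lambda>i. y ^ q ^ i))"
    if y: "card ((\<lambda>u. \<beta> u - y * \<alpha> u) ` U) \<le> q ^ m" for y
  proof -
    obtain j c where j: "card ((\<lambda>u. \<beta> u - y * \<alpha> u) ` U) = q ^ j" and c: "c j = 1"
      and ann: "\<And>v. v \<in> (\<lambda>u. \<beta> u - y * \<alpha> u) ` U \<Longrightarrow> (\<Sum>i\<le>j. c i * v ^ q ^ i) = 0"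
      using F_subspace_annihilator[OF sub] by metis
    have jm: "j \<le> m" using y j q_gt_1 by simp
    define c' where "c' i = (if i \<le> j then c i else 0)" for i
    define Y where "Y = y ^ q ^ m"
    \<comment> \<open>\<open>b m - Y a m = (1 - Y) b m + Y (b m - a m)\<close> distributes the \<open>m\<close>-th coefficient\<close>
    define d where "d i = (if i < m then c' i else if i = m then c' m * (1 - Y) else c' m * Y)" for i
    have zero: "(\<Sum>i\<le>m. c' i *s (b i - y ^ q ^ i *s a i)) = 0"
    proof (subst vec_eq_iff, rule allI)
      fix u
      show "(\<Sum>i\<le>m. c' i *s (b i - y ^ q ^ i *s a i)) $ u = 0 $ u"
      proof (cases "u \<in> U")
        case True
        have "(\<Sum>i\<le>m. c' i *s (b i - y ^ q ^ i *s a i)) $ u = (\<Sum>i\<le>m. c' i * (\<beta> u - y * \<alpha> u) ^ q ^ i)"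
          using True by (simp add: a_def b_def pow_vec_nth frob_diff power_mult_distrib algebra_simps)
        also have "\<dots> = (\<Sum>i\<le>j. c i * (\<beta> u - y * \<alpha> u) ^ q ^ i)"
          using jm by (intro sum.mono_neutral_cong_right) (auto simp: c'_def)
        also have "\<dots> = 0" using ann True by blast
        finally show ?thesis by simp
      next
        case False
        then show ?thesis by (simp add: a_def b_def pow_vec_def)
      qed
    qed
    have sum2: "(\<Sum>i<m + 2. f i) = (\<Sum>i<m. f i) + f m + f (m + 1)" for f :: "nat \<Rightarrow> 'a ^ 'x"
      by (simp add: numeral_2_eq_2)
    have "(\<Sum>i<m + 2. d i *s rw (\<lambda>i. y ^ q ^ i) i) =
        (\<Sum>i<m. d i *s rw (\<lambda>i. y ^ q ^ i) i) + (c' m * (1 - Y)) *s b m + (c' m * Y) *s (b m - a m)"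
      unfolding sum2 by (simp add: d_def[of m] d_def[of "m + 1"] d_def[of "Suc m"] rw_def b'_def)
    also have "(\<Sum>i<m. d i *s rw (\<lambda>i. y ^ q ^ i) i) = (\<Sum>i<m. c' i *s (b i - y ^ q ^ i *s a i))"
      by (intro sum.cong) (auto simp: d_def rw_def b'_def)
    also have "\<dots> + (c' m * (1 - Y)) *s b m + (c' m * Y) *s (b m - a m) = 
        \<dots> + c' m *s (b m - Y *s a m)"
      by (simp add: vec_eq_iff algebra_simps)
    also have "\<dots> = 0"
      using zero by (simp add: Y_def lessThan_Suc_atMost[symmetric])
    finally have "(\<Sum>i<m + 2. d i *s rw (\<lambda>i. y ^ q ^ i) i) = 0" .
    moreover have "\<exists>i<m + 2. d i \<noteq> 0"
    proof (cases "j < m")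
      case True
      then show ?thesis using c by (intro exI[of _ j]) (auto simp: d_def c'_def)
    next
      case False
      then have "c' m = 1" using jm c by (simp add: c'_def)
      then have "d m \<noteq> 0 \<or> d (m + 1) \<noteq> 0" by (auto simp: d_def)
      then show ?thesis
      proof
        assume "d m \<noteq> 0"
        then show ?thesis by (intro exI[of _ m]) simp
      next
        assume "d (m + 1) \<noteq> 0"
        then show ?thesis by (intro exI[of _ "m + 1"]) simp
      qed
    qed
    ultimately show ?thesis unfolding indep_family_def by blast
  qed
  have no_choice: "\<not> indep_family (m + 2) (rw t)" for t
  proof
    assume "indep_family (m + 2) (rw t)"
    then have "card {y. \<not> indep_family (m + 2) (rw (\<lambda>i. y ^ q ^ i))} \<le> (\<Sum>i<m. q ^ i)"
      unfolding rw_def by (intro card_dependent_values_le) (use q_gt_1 in auto)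
    moreover have "card {y. card ((\<lambda>u. \<beta> u - y * \<alpha> u) ` U) \<le> q ^ m} \<le>
        card {y. \<not> indep_family (m + 2) (rw (\<lambda>i. y ^ q ^ i))}"
      using dep by (intro card_mono) auto
    ultimately show False using many sum_powers_less[OF q_gt_1, of m] by linarith
  qed
  define S where "S i = (if i < m then T i else {b' i})" for i
  have "\<exists>J\<subseteq>{..<m + 2}. vec.dim (\<Union>j\<in>J. S j) < card J"
  proof (rule ccontr)
    assume "\<not> ?thesis"
    then have "\<exists>v. (\<forall>i\<in>{..<m + 2}. v i \<in> S i) \<and> card {..<m + 2} \<le> vec.dim (v ` {..<m + 2})"
      by (intro rado) (auto simp: S_def T_def not_less)
    then obtain v where v: "\<And>i. i < m + 2 \<Longrightarrow> v i \<in> S i" "m + 2 \<le> vec.dim (v ` {..<m + 2})"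
      by auto
    define t where "t i = (if v i = b i then 0 else 1 :: 'a)" for i
    have "v i = rw t i" if "i < m + 2" for i
      using v(1)[OF that] by (auto simp: S_def T_def rw_def t_def b'_def)
    then have "v ` {..<m + 2} = rw t ` {..<m + 2}" by auto
    then have "indep_family (m + 2) (rw t)"
      using v(2) by (intro indep_family_if_dim) simp
    then show False using no_choice by blast
  qed
  then obtain J where J: "J \<subseteq> {..<m + 2}" "vec.dim (\<Union>j\<in>J. S j) < card J" by blast
  define J' where "J' = J \<inter> {..<m}"
  have finJ: "finite J" using J finite_subset by blast
  have "(\<Union>j\<in>J'. T j) \<subseteq> (\<Union>j\<in>J. S j)" by (auto simp: J'_def S_def)
  then have J'dim: "vec.dim (\<Union>j\<in>J'. T j) \<le> vec.dim (\<Union>j\<in>J. S j)" by (rule vec.dim_subset)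
  have split: "J = J' \<union> (J \<inter> {m, m + 1})" using J by (auto simp: J'_def)
  have disj: "J' \<inter> (J \<inter> {m, m + 1}) = {}" by (auto simp: J'_def)
  have cardJ: "card J = card J' + card (J \<inter> {m, m + 1})"
    using card_Un_disjoint[OF _ _ disj] finJ split by (simp add: J'_def)
  have "\<exists>Z. Z \<subseteq> {..m} \<and> Z \<noteq> {} \<and> vec.dim (\<Union>i\<in>Z. T i) \<le> card Z"
  proof (cases "m \<in> J \<and> m + 1 \<in> J")
    case True
    define Z where "Z = insert m J'"
    have "(\<Union>i\<in>Z. T i) \<subseteq> (\<Union>j\<in>J. S j)"
    proof -
      have "S m = {b m}" "S (m + 1) = {b m - a m}" by (auto simp: S_def b'_def)
      then have "T m \<subseteq> (\<Union>j\<in>J. S j)" using True by (force simp: T_def)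
      then show ?thesis using \<open>(\<Union>j\<in>J'. T j) \<subseteq> (\<Union>j\<in>J. S j)\<close> by (auto simp: Z_def)
    qed
    then have "vec.dim (\<Union>i\<in>Z. T i) < card J" using J(2) vec.dim_subset le_less_trans by blast
    moreover have "J \<inter> {m, m + 1} = {m, m + 1}" using True by auto
    then have "card J = card J' + 2" using cardJ by simp
    moreover have "card Z = card J' + 1"
      using finJ by (simp add: Z_def J'_def)
    ultimately show ?thesis by (intro exI[of _ Z]) (auto simp: Z_def J'_def)
  next
    case False
    then have "J \<inter> {m, m + 1} \<subseteq> {m} \<or> J \<inter> {m, m + 1} \<subseteq> {m + 1}" by auto
    then have le1: "card (J \<inter> {m, m + 1}) \<le> 1"
      using card_mono[of "{m}"] card_mono[of "{m + 1}"] by fastforce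
    show ?thesis
    proof (cases "J' = {}")
      case False
      then show ?thesis using J(2) J'dim cardJ le1
        by (intro exI[of _ J']) (auto simp: J'_def)
    next
      case True
      then have "card J = 1" using J(2) cardJ le1 by simp
      then obtain i where i: "J = {i}" by (auto simp: card_Suc_eq numeral_eq_Suc)
      then have "i \<in> {m, m + 1}" using split True by auto
      then have "S i = {b' i}" by (auto simp: S_def)
      then have "b' i = 0" using J(2) i by (simp split: if_splits)
      then have "b m = 0 \<or> b m - a m = 0" using \<open>i \<in> {m, m + 1}\<close> by (auto simp: b'_def)
      moreover have "a m \<in> vec.span {a m}" by (rule vec.span_base) simp
      ultimately have "T m \<subseteq> vec.span {a m}"
        using vec.span_neg[of "a m" "{a m}"] vec.span_zero[of "{a m}"] by (auto simp: T_def)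
      then have "vec.dim (T m) \<le> 1" using vec.dim_le_card[of "T m" "{a m}"] by simp
      then show ?thesis by (intro exI[of _ "{m}"]) auto
    qed
  qed
  then show ?thesis by (simp add: T_def)
qed

end

section \<open>Linearity over a larger field\<close>

context frobenius_field
begin

lemma F_subspace_image:
  fixes g :: "'a ^ 'm \<Rightarrow> 'a"
  assumes U: "subspace_over F U"
    and g: "\<And>x y. g (x + y) = g x + g y" "\<And>c x. g (c *s x) = c * g x"
  shows "F_subspace (g ` U)"
  unfolding F_subspace_def
proof (intro conjI ballI)
  have "g 0 = 0" using g(2)[of 0 0] by simp
  moreover have "0 \<in> U" using U by (simp add: subspace_over_def)
  ultimately show "0 \<in> g ` U" by (metis imageI)
  fix v w assume "v \<in> g ` U" "w \<in> g ` U"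
  then obtain u u' where "u \<in> U" "u' \<in> U" "v = g u" "w = g u'" by blast
  then have "v + w = g (u + u')" "u + u' \<in> U" using U by (auto simp: g subspace_over_def)
  then show "v + w \<in> g ` U" by blast
next
  fix c v assume "c \<in> F" "v \<in> g ` U"
  then obtain u where "u \<in> U" "v = g u" by blast
  then have "c * v = g (c *s u)" "c *s u \<in> U" using U \<open>c \<in> F\<close> by (auto simp: g subspace_over_def)
  then show "c * v \<in> g ` U" by blast
qed

lemma subspace_over_diff:
  assumes U: "subspace_over F U" and "u \<in> U" "v \<in> U"
  shows "u - v \<in> U"
proof -
  have "- 1 \<in> F" using subfield_F by (simp add: is_subfield_def)
  then have "u + (- 1) *s v \<in> U" using assms unfolding subspace_over_def by blast
  then show ?thesis by (simp add: vec_eq_iff)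
qed

text \<open>
  The two equations on \<open>U\<close> define a subspace \<open>W\<close> over the field \<open>K\<close> of order \<open>q ^ s\<close>. On \<open>W\<close> the
  form \<open>\<alpha>\<close> determines \<open>\<beta>\<close> and takes at most \<open>q ^ (s * d)\<close> values. A nonzero \<open>w\<close> in \<open>W\<close> with
  \<open>K w \<inter> U = {0}\<close> would give \<open>q ^ (s + k)\<close> elements \<open>x w + u\<close> of \<open>W\<close>, which are too many; so every
  point of the linear set of \<open>W\<close> is a point of that of \<open>U\<close>.
\<close>
lemma linear_set_over_fixed_field:
  fixes U :: "('a ^ 2) set" and \<alpha> \<beta> :: "'a ^ 2 \<Rightarrow> 'a"
  assumes U: "subspace_over F U" and card_U: "card U = q ^ k"
    and \<alpha>: "\<And>x y. \<alpha> (x + y) = \<alpha> x + \<alpha> y" "\<And>c x. \<alpha> (c *s x) = c * \<alpha> x"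
    and \<beta>: "\<And>x y. \<beta> (x + y) = \<beta> x + \<beta> y" "\<And>c x. \<beta> (c *s x) = c * \<beta> x"
    and coords: "\<And>x. \<alpha> x = 0 \<Longrightarrow> \<beta> x = 0 \<Longrightarrow> x = 0"
    and s: "s > 0" "s dvd n" and d: "d > 0" and small: "s * d < s + k"
    and c: "\<And>u. u \<in> U \<Longrightarrow> \<alpha> u ^ q ^ (s * d) = (\<Sum>i<d. c i * \<alpha> u ^ q ^ (s * i))"
    and e: "\<And>u. u \<in> U \<Longrightarrow> \<beta> u = (\<Sum>i<d. e i * \<alpha> u ^ q ^ (s * i))"
  shows "linear_set_over {x :: 'a. x ^ q ^ s = x} (linear_set U)"
proof -
  have \<alpha>_diff: "\<alpha> (x - y) = \<alpha> x - \<alpha> y" for x y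
    using \<alpha>(1)[of "x - y" y] by (simp add: algebra_simps)
  have \<beta>_diff: "\<beta> (x - y) = \<beta> x - \<beta> y" for x y
    using \<beta>(1)[of "x - y" y] by (simp add: algebra_simps)
  define W where "W = {w. \<alpha> w ^ q ^ (s * d) = (\<Sum>i<d. c i * \<alpha> w ^ q ^ (s * i)) \<and>
                         \<beta> w = (\<Sum>i<d. e i * \<alpha> w ^ q ^ (s * i))}"
  define K where "K = {x :: 'a. x ^ q ^ s = x}"
  have card_K: "card K = q ^ s" unfolding K_def using s by (intro card_fixed_field)
  have K_frob: "x ^ q ^ (s * i) = x" if "x \<in> K" for x i
    using that frob_fixed by (simp add: K_def)
  have UW: "U \<subseteq> W" using c e by (auto simp: W_def)
  have W: "subspace_over K W"
    unfolding subspace_over_def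
  proof (intro conjI ballI)
    show "0 \<in> W" using UW U by (auto simp: subspace_over_def)
    fix v w assume "v \<in> W" "w \<in> W"
    then show "v + w \<in> W"
      by (simp add: W_def \<alpha> \<beta> frob_add sum.distrib algebra_simps)
  next
    fix x w assume "x \<in> K" "w \<in> W"
    then show "x *s w \<in> W"
      by (simp add: W_def \<alpha> \<beta> power_mult_distrib K_frob sum_distrib_left mult.left_commute)
  qed
  have card_W: "card W \<le> q ^ (s * d)"
  proof -
    define P where "P = monom 1 (q ^ (s * d)) + (\<Sum>i<d. monom (- c i) (q ^ (s * i)))"
    have degree_less: "degree (\<Sum>i<d. monom (- c i) (q ^ (s * i))) < q ^ (s * d)"
    proof (rule le_less_trans)
      show "degree (\<Sum>i<d. monom (- c i) (q ^ (s * i))) \<le> q ^ (s * (d - 1))"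
      proof (rule degree_sum_le)
        fix i assume "i \<in> {..<d}"
        then have "q ^ (s * i) \<le> q ^ (s * (d - 1))"
          using q_gt_1 by (intro power_increasing mult_le_mono2) auto
        then show "degree (monom (- c i) (q ^ (s * i))) \<le> q ^ (s * (d - 1))"
          by (meson degree_monom_le le_trans)
      qed simp
      show "q ^ (s * (d - 1)) < q ^ (s * d)"
        using q_gt_1 s(1) d by (intro power_strict_increasing) auto
    qed
    have degP: "degree P = q ^ (s * d)"
      unfolding P_def using degree_less by (subst degree_add_eq_left) (auto simp: degree_monom_eq)
    then have P0: "P \<noteq> 0" using q_gt_1 by auto
    have "card W = card (\<alpha> ` W)"
    proof (rule card_image[symmetric], rule inj_onI)
      fix v w assume vw: "v \<in> W" "w \<in> W" "\<alpha> v = \<alpha> w"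
      then have "\<beta> v = \<beta> w" by (simp add: W_def)
      then have "v - w = 0" using vw by (intro coords) (simp_all add: \<alpha>_diff \<beta>_diff)
      then show "v = w" by simp
    qed
    also have "\<alpha> ` W \<subseteq> {x. poly P x = 0}"
      by (auto simp: W_def P_def poly_sum poly_monom sum_negf)
    then have "card (\<alpha> ` W) \<le> card {x. poly P x = 0}" by (intro card_mono) auto
    also have "\<dots> \<le> q ^ (s * d)" using card_poly_roots_bound[OF P0] degP by simp
    finally show ?thesis .
  qed
  have "linear_set W \<subseteq> linear_set U"
  proof
    fix P assume "P \<in> linear_set W"
    then obtain w where w: "w \<in> W" "w \<noteq> 0" "P = vec.span {w}" by (auto simp: linear_set_def)
    define h where "h = (\<lambda>(x, u). x *s w + u)"
    have "h ` (K \<times> U) \<subseteq> W"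
      using W w UW by (auto simp: h_def subspace_over_def)
    then have "card (h ` (K \<times> U)) \<le> card W" by (intro card_mono) auto
    also have "\<dots> \<le> q ^ (s * d)" by (rule card_W)
    also have "\<dots> < q ^ (s + k)"
      using q_gt_1 small by (intro power_strict_increasing) auto
    also have "\<dots> = card (K \<times> U)"
      by (simp add: card_cartesian_product card_K card_U power_add)
    finally have "\<not> inj_on h (K \<times> U)" by (auto dest: card_image)
    then obtain x x' u u' where *: "u \<in> U" "u' \<in> U" "(x, u) \<noteq> (x', u')" "x *s w + u = x' *s w + u'"
      by (auto simp: inj_on_def h_def)
    define t where "t = x - x'"
    have tw: "t *s w = u' - u"
      using *(4) by (simp add: t_def vec.scale_left_diff_distrib algebra_simps)
    have "t \<noteq> 0" using tw * by (auto simp: t_def)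
    have "t *s w \<in> U" using subspace_over_diff[OF U] * tw by simp
    moreover have "t *s w \<noteq> 0" using \<open>t \<noteq> 0\<close> w by simp
    moreover have "vec.span {t *s w} = vec.span {w}"
      using vec.span_image_scale[of "{w}" "\<lambda>_. t"] \<open>t \<noteq> 0\<close> by simp
    ultimately show "P \<in> linear_set U"
      using w by (auto simp: linear_set_def intro!: exI[of _ "t *s w"])
  qed
  moreover have "linear_set U \<subseteq> linear_set W" using UW by (auto simp: linear_set_def)
  ultimately have "linear_set U = linear_set W" by blast
  then show ?thesis
    using W unfolding linear_set_over_def K_def by blast
qed

text \<open>
  A minimal tight set, moved to begin at \<open>0\<close>, has a maximum \<open>M \<le> m\<close>, so the vectors \<open>a i\<close>, \<open>b i\<close>
  with \<open>s\<close> dividing \<open>i\<close> span a space of dimension at most \<open>d = M / s + 1\<close>. The \<open>d\<close> vectors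
  \<open>a 0, a s, \<dots>, a (s * (d - 1))\<close> are independent, hence a basis, and expanding
  \<open>a (s * d)\<close> and \<open>b 0\<close> in it gives the two equations of the previous lemma. The case \<open>s = 1\<close> is
  impossible: \<open>a 0, \<dots>, a (M + 1)\<close> would be \<open>M + 2 \<le> k\<close> independent vectors in dimension \<open>M + 1\<close>.
\<close>
lemma linear_over_extension:
  fixes U :: "('a ^ 2) set" and \<alpha> \<beta> :: "'a ^ 2 \<Rightarrow> 'a"
  assumes U: "subspace_over F U" and card_U: "card U = q ^ k"
    and \<alpha>: "\<And>x y. \<alpha> (x + y) = \<alpha> x + \<alpha> y" "\<And>c x. \<alpha> (c *s x) = c * \<alpha> x"
    and \<beta>: "\<And>x y. \<beta> (x + y) = \<beta> x + \<beta> y" "\<And>c x. \<beta> (c *s x) = c * \<beta> x"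
    and coords: "\<And>x. \<alpha> x = 0 \<Longrightarrow> \<beta> x = 0 \<Longrightarrow> x = 0"
    and inj: "\<And>u. u \<in> U \<Longrightarrow> \<alpha> u = 0 \<Longrightarrow> u = 0"
    and many: "q ^ m \<le> card {y. card ((\<lambda>u. \<beta> u - y * \<alpha> u) ` U) \<le> q ^ m}"
    and mk: "m + 2 \<le> k"
  shows "\<exists>s>1. s dvd n \<and> linear_set_over {x :: 'a. x ^ q ^ s = x} (linear_set U)"
proof -
  have \<alpha>_diff: "\<alpha> (x - y) = \<alpha> x - \<alpha> y" for x y
    using \<alpha>(1)[of "x - y" y] by (simp add: algebra_simps)
  have inj_U: "inj_on \<alpha> U"
    by (rule inj_onI) (metis subspace_over_diff[OF U] \<alpha>_diff inj right_minus_eq)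
  define a where "a = pow_vec U \<alpha>"
  define b where "b = pow_vec U \<beta>"
  define T where "T i = {b i, b i - a i}" for i
  define D where "D X = vec.dim (\<Union>i\<in>X. T i)" for X
  have "F_subspace ((\<lambda>u. \<beta> u - y * \<alpha> u) ` U)" for y
    by (rule F_subspace_image[OF U]) (simp_all add: \<alpha> \<beta> algebra_simps)
  then have "\<exists>Z. Z \<subseteq> {..m} \<and> Z \<noteq> {} \<and> D Z \<le> card Z"
    using exists_tight_set[of \<beta> \<alpha> U m] many unfolding D_def T_def a_def b_def by blast
  then obtain Z where Z: "Z \<subseteq> {..m}" "Z \<noteq> {}" "D Z \<le> card Z"
    and minimal: "\<And>Y. Y \<subseteq> {..m} \<Longrightarrow> Y \<noteq> {} \<Longrightarrow> D Y \<le> card Y \<Longrightarrow> card Z \<le> card Y"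
    using ex_has_least_nat[of "\<lambda>Z. Z \<subseteq> {..m} \<and> Z \<noteq> {} \<and> D Z \<le> card Z" _ card] by metis
  have finZ: "finite Z" using Z finite_subset by blast
  have T_shift: "T (j + i) = frob_vec j ` T i" for i j
    by (simp add: T_def a_def b_def pow_vec_add frob_vec_diff)
  have shift: "D ((+) j ` X) = D X" for X j
  proof -
    have "(\<Union>i\<in>(+) j ` X. T i) = frob_vec j ` (\<Union>i\<in>X. T i)"
      by (simp add: T_shift image_UN)
    then show ?thesis by (simp add: D_def dim_frob_vec)
  qed
  have period: "T (i + n) = T i" for i
    by (simp add: T_def a_def b_def pow_vec_period)
  define j where "j = Min Z"
  define Z' where "Z' = (\<lambda>z. z - j) ` Z"
  have jZ: "j \<in> Z" and jle: "\<And>z. z \<in> Z \<Longrightarrow> j \<le> z"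
    using finZ Z by (auto simp: j_def)
  have ZZ': "Z = (+) j ` Z'" using jle by (force simp: Z'_def)
  have card_Z': "card Z' = card Z" unfolding ZZ' by (rule card_image[symmetric]) simp
  have Z'0: "0 \<in> Z'" using jZ by (force simp: Z'_def)
  have finZ': "finite Z'" using finZ by (simp add: Z'_def)
  define M where "M = Max Z'"
  have "M \<in> Z'" unfolding M_def using finZ' Z'0 by (intro Max_in) auto
  then have Mm: "M \<le> m" using Z(1) by (auto simp: Z'_def)
  have "\<exists>s>0. s dvd n \<and> s dvd Max Z' \<and> vec.dim (\<Union>i\<in>{i. s dvd i}. T i) \<le> Max Z' div s + 1"
  proof (rule dim_multiples_le[of T n Z'])
    show "vec.dim (\<Union>i\<in>(+) j ` X. T i) = vec.dim (\<Union>i\<in>X. T i)" for X j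
      using shift unfolding D_def .
    show "vec.dim (\<Union>i\<in>Z'. T i) \<le> card Z'"
      using Z(3) shift[of j Z'] card_Z' unfolding ZZ'[symmetric] D_def by simp
    fix Y assume Y: "Y \<subset> Z'" "Y \<noteq> {}"
    show "card Y < vec.dim (\<Union>i\<in>Y. T i)"
    proof (rule ccontr)
      assume "\<not> ?thesis"
      then have "D Y \<le> card Y" by (simp add: D_def)
      moreover have "card ((+) j ` Y) = card Y" by (rule card_image) simp
      moreover have "(+) j ` Y \<subseteq> Z" unfolding ZZ' using Y by blast
      ultimately have "card Z \<le> card Y"
        using minimal[of "(+) j ` Y"] Y Z(1) shift[of j Y] by (metis image_is_empty order_trans)
      moreover have "card Y < card Z'" using finZ' Y(1) by (rule psubset_card_mono)
      ultimately show False using card_Z' by simp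
    qed
  qed (use n_pos period finZ' Z'0 in auto)
  then obtain s where s: "s > 0" "s dvd n" "s dvd M"
    and dim: "vec.dim (\<Union>i\<in>{i. s dvd i}. T i) \<le> M div s + 1"
    unfolding M_def by blast
  define d where "d = M div s + 1"
  have sd: "s * d = M + s" using s by (simp add: d_def algebra_simps)
  define V where "V = vec.span (\<Union>i\<in>{i. s dvd i}. T i)"
  have dimV: "vec.dim V \<le> d" using dim by (simp add: V_def d_def)
  have bV: "b i \<in> V" if "s dvd i" for i
    unfolding V_def using that by (intro vec.span_base) (auto simp: T_def)
  have aV: "a i \<in> V" if "s dvd i" for i
  proof -
    have "b i - a i \<in> V"
      unfolding V_def using that by (intro vec.span_base) (auto simp: T_def)
    with bV[OF that] have "b i - (b i - a i) \<in> V"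
      unfolding V_def by (rule vec.span_diff)
    then show ?thesis by simp
  qed
  have "indep_family k a"
    unfolding a_def by (rule pow_vec_indep[OF inj_U card_U])
  then have a_inj: "inj_on a {..<k}" and a_ind: "vec.independent (a ` {..<k})"
    by (auto simp: indep_family_iff)
  have a_sub: "card (a ` I) = card I" "vec.independent (a ` I)" if "I \<subseteq> {..<k}" for I
    using inj_on_subset[OF a_inj that] vec.independent_mono[OF a_ind image_mono[OF that]]
    by (auto intro: card_image)
  have s1: "s > 1"
  proof (rule ccontr)
    assume "\<not> ?thesis"
    then have "s = 1" using s by simp
    have "card (a ` {..<M + 2}) \<le> vec.dim V"
      using a_sub(2)[of "{..<M + 2}"] Mm mk aV \<open>s = 1\<close>
      by (intro vec.independent_card_le_dim) auto
    then show False using a_sub(1)[of "{..<M + 2}"] Mm mk dimV \<open>s = 1\<close> by (simp add: d_def)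
  qed
  have lt: "s * i < k" if "i < d" for i
  proof -
    have "s * Suc i \<le> s * d" using that by (intro mult_le_mono2) simp
    then show ?thesis using sd Mm mk by simp
  qed
  define I where "I = (*) s ` {..<d}"
  have Ik: "I \<subseteq> {..<k}" using lt by (auto simp: I_def)
  have cardI: "card I = d"
    unfolding I_def using s(1) by (subst card_image) (auto simp: inj_on_def)
  have "V \<subseteq> vec.span (a ` I)"
  proof (rule vec.card_ge_dim_independent)
    show "a ` I \<subseteq> V" using aV by (auto simp: I_def)
    show "vec.independent (a ` I)" by (rule a_sub(2)[OF Ik])
    show "vec.dim V \<le> card (a ` I)" using dimV a_sub(1)[OF Ik] cardI by simp
  qed
  then have V_span: "V \<subseteq> vec.span ((\<lambda>i. a (s * i)) ` {..<d})"
    by (simp add: I_def image_image)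
  obtain c where c: "a (s * d) = (\<Sum>i<d. c i *s a (s * i))"
    using span_image_coeffs[of "a (s * d)" "\<lambda>i. a (s * i)" "{..<d}"] V_span aV[of "s * d"] by auto
  obtain e where e: "b 0 = (\<Sum>i<d. e i *s a (s * i))"
    using span_image_coeffs[of "b 0" "\<lambda>i. a (s * i)" "{..<d}"] V_span bV[of 0] by auto
  have "linear_set_over {x :: 'a. x ^ q ^ s = x} (linear_set U)"
  proof (rule linear_set_over_fixed_field[OF U card_U \<alpha> \<beta> coords s(1,2)])
    show "d > 0" by (simp add: d_def)
    show "s * d < s + k" using sd Mm mk by simp
    fix u assume u: "u \<in> U"
    have "a (s * d) $ u = (\<Sum>i<d. c i *s a (s * i)) $ u" "b 0 $ u = (\<Sum>i<d. e i *s a (s * i)) $ u"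
      using c e by simp_all
    then show "\<alpha> u ^ q ^ (s * d) = (\<Sum>i<d. c i * \<alpha> u ^ q ^ (s * i))"
        "\<beta> u = (\<Sum>i<d. e i * \<alpha> u ^ q ^ (s * i))"
      using u by (simp_all add: a_def b_def pow_vec_nth)
  qed
  then show ?thesis using s1 s(2) by blast
qed

lemma card_basis_over:
  fixes U :: "('a ^ 'm) set"
  assumes "has_dim_over F U k"
  shows "card U = q ^ k"
proof -
  obtain B where B: "finite B" "{\<Sum>b\<in>B. c b *s b | c. \<forall>b\<in>B. c b \<in> F} = U" "card B = k"
    and ind: "\<And>c. \<forall>b\<in>B. c b \<in> F \<Longrightarrow> (\<Sum>b\<in>B. c b *s b) = 0 \<Longrightarrow> \<forall>b\<in>B. c b = 0"
    using assms unfolding has_dim_over_def basis_over_def by blast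
  have F_diff: "x - y \<in> F" if "x \<in> F" "y \<in> F" for x y
    using subfield_F that unfolding is_subfield_def by (metis diff_conv_add_uminus)
  define h where "h = (\<lambda>c. \<Sum>b\<in>B. c b *s b)"
  have "h ` (B \<rightarrow>\<^sub>E F) = U"
  proof
    show "h ` (B \<rightarrow>\<^sub>E F) \<subseteq> U" using B(2) by (auto simp: h_def PiE_def Pi_def)
    show "U \<subseteq> h ` (B \<rightarrow>\<^sub>E F)"
    proof
      fix u assume "u \<in> U"
      then obtain c where c: "u = (\<Sum>b\<in>B. c b *s b)" "\<forall>b\<in>B. c b \<in> F" using B(2) by blast
      then have "u = h (restrict c B)" by (simp add: h_def)
      moreover have "restrict c B \<in> B \<rightarrow>\<^sub>E F" using c by auto
      ultimately show "u \<in> h ` (B \<rightarrow>\<^sub>E F)" by blast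
    qed
  qed
  moreover have "inj_on h (B \<rightarrow>\<^sub>E F)"
  proof (rule inj_onI)
    fix c c' assume c: "c \<in> B \<rightarrow>\<^sub>E F" "c' \<in> B \<rightarrow>\<^sub>E F" "h c = h c'"
    have "(\<Sum>b\<in>B. (c b - c' b) *s b) = h c - h c'"
      by (simp add: h_def vec.scale_left_diff_distrib sum_subtractf)
    then have "\<forall>b\<in>B. c b - c' b = 0"
      using c F_diff by (intro ind) (auto simp: PiE_def Pi_def)
    then show "c = c'" using c by (auto intro: PiE_ext)
  qed
  ultimately have "card U = card (B \<rightarrow>\<^sub>E F)" by (metis card_image)
  then show ?thesis using B by (simp add: card_PiE card_F)
qed

end

section \<open>The minimum size\<close>

text \<open>
  For nonzero \<open>p\<close>, the linear form with kernel spanned by \<open>p\<close>. With \<open>bracket p\<close> and \<open>bracket r\<close> as coordinates, the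
  point \<open>p\<close> is at infinity, and the affine point with parameter \<open>y\<close> is spanned by \<open>r - y p\<close>.
\<close>
definition bracket :: "'a::field ^ 2 \<Rightarrow> 'a ^ 2 \<Rightarrow> 'a" where
  "bracket p u = p $ 1 * u $ 2 - p $ 2 * u $ 1"

lemma bracket_add: "bracket p (u + v) = bracket p u + bracket p v"
  by (simp add: bracket_def algebra_simps)

lemma bracket_scale: "bracket p (c *s u) = c * bracket p u"
  by (simp add: bracket_def algebra_simps)

lemma bracket_diff_left: "bracket (r - y *s p) u = bracket r u - y * bracket p u"
  by (simp add: bracket_def algebra_simps)

lemma bracket_swap: "bracket u p = - bracket p u"
  by (simp add: bracket_def)

lemma bracket_eq_0_iff:
  assumes "p \<noteq> 0"
  shows "bracket p u = 0 \<longleftrightarrow> (\<exists>c. u = c *s p)"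
proof
  assume bracket: "bracket p u = 0"
  show "\<exists>c. u = c *s p"
  proof (cases "p $ 1 = 0")
    case True
    then have "p $ 2 \<noteq> 0" using assms by (auto simp: vec_eq_iff forall_2)
    then show ?thesis using True bracket
      by (intro exI[of _ "u $ 2 / p $ 2"]) (auto simp: vec_eq_iff forall_2 bracket_def)
  next
    case False
    then show ?thesis using bracket
      by (intro exI[of _ "u $ 1 / p $ 1"]) (auto simp: vec_eq_iff forall_2 bracket_def field_simps)
  qed
qed (auto simp: bracket_def)

lemma span_eq_iff_bracket:
  fixes p u :: "'a::field ^ 2"
  assumes "p \<noteq> 0" "u \<noteq> 0"
  shows "vec.span {p} = vec.span {u} \<longleftrightarrow> bracket p u = 0"
proof
  assume "vec.span {p} = vec.span {u}"
  then have "u \<in> vec.span {p}" by (simp add: vec.span_base)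
  then show "bracket p u = 0" by (auto simp: bracket_eq_0_iff[OF assms(1)] vec.span_singleton)
next
  assume "bracket p u = 0"
  then obtain c where c: "u = c *s p" using bracket_eq_0_iff[OF assms(1)] by blast
  then have "c \<noteq> 0" using assms by auto
  then show "vec.span {p} = vec.span {u}"
    using vec.span_image_scale[of "{p}" "\<lambda>_. c"] c by simp
qed

lemma card_ge_affine_part:
  fixes L :: "('a::{field, finite} ^ 2) set set"
  assumes pr: "bracket p r \<noteq> 0" and p: "vec.span {p} \<in> L"
    and Y: "\<And>y. y \<in> Y \<Longrightarrow> vec.span {r - y *s p} \<in> L"
  shows "card Y + 1 \<le> card L"
proof -
  define f where "f y = vec.span {r - y *s p}" for y
  have p0: "p \<noteq> 0" using pr by (auto simp: bracket_def)
  have br_p: "bracket p (r - y *s p) = bracket p r" for y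
    by (simp add: bracket_def algebra_simps)
  have ne: "r - y *s p \<noteq> 0" for y using br_p[of y] pr by (auto simp: bracket_def)
  have "inj_on f Y"
  proof (rule inj_onI)
    fix y y' assume "f y = f y'"
    then have "bracket (r - y *s p) (r - y' *s p) = 0"
      unfolding f_def using span_eq_iff_bracket[OF ne ne] by blast
    moreover have "bracket (r - y *s p) (r - y' *s p) = (y' - y) * bracket p r"
      by (simp add: bracket_def algebra_simps)
    ultimately show "y = y'" using pr by simp
  qed
  then have "card (f ` Y) = card Y" by (rule card_image)
  moreover have "vec.span {p} \<notin> f ` Y"
    using span_eq_iff_bracket[OF p0 ne] br_p pr by (auto simp: f_def)
  ultimately have "card (insert (vec.span {p}) (f ` Y)) = card Y + 1" by simp
  moreover have "insert (vec.span {p}) (f ` Y) \<subseteq> L" using p Y by (auto simp: f_def)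
  ultimately show ?thesis by (metis card_mono finite)
qed

theorem mainTheorem5:
  fixes q n k :: nat
    and Fq :: "'a::{field, finite} set"
    and L :: "('a^2) set set"
  assumes "primepow q" and "n \<ge> 2"
    and "CARD('a) = q ^ n"
    and "is_subfield Fq" and "card Fq = q"
    and "linear_set_of_rank Fq k L"
    and "maximum_field_of_linearity q n L Fq"
    and "k \<le> n"
  shows "card L \<ge> q ^ (k - 1) + 1"
proof -
  have q: "q > 1" using \<open>primepow q\<close> using primepow_gt_Suc_0[of q] by simp
  interpret frobenius_field q n Fq
    using q assms freshman_power_field_order[OF assms(1,3)] by unfold_locales auto
  have max: "s \<le> 1" if "s dvd n" "is_subfield E" "card E = q ^ s" "linear_set_over E L" for s E
  proof -
    obtain t where "card Fq = q ^ t" and t: "\<forall>s E. s dvd n \<and> is_subfield E \<and> card E = q ^ s \<and> linear_set_over E L \<longrightarrow> s \<le> t"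
      using assms(7) unfolding maximum_field_of_linearity_def by blast
    then have "q ^ 1 = q ^ t" using assms(5) by simp
    then have "t = 1" using q power_inject_exp by metis
    then show ?thesis using t that by blast
  qed
  have not_UNIV: "\<not> linear_set_over UNIV L"
    using max[of n UNIV] assms(2,3) by (auto simp: is_subfield_def)
  obtain U where U: "subspace_over Fq U" "has_dim_over Fq U k" and L: "L = linear_set U"
    using assms(6) unfolding linear_set_of_rank_def by blast
  have card_U: "card U = q ^ k" using U(2) by (rule card_basis_over)
  have U0: "0 \<in> U" using U(1) by (simp add: subspace_over_def)
  have in_L: "vec.span {p} \<in> L" if "u \<in> U" "u \<noteq> 0" "bracket p u = 0" "p \<noteq> 0" for p u
  proof -
    have "vec.span {p} = vec.span {u}" using span_eq_iff_bracket that by blast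
    then show ?thesis using that by (auto simp: L linear_set_def)
  qed
  have "U \<noteq> {0}"
  proof
    assume "U = {0}"
    then have "subspace_over UNIV U" by (simp add: subspace_over_def)
    then show False using not_UNIV L unfolding linear_set_over_def by blast
  qed
  then have ne: "U - {0} \<noteq> {}" using U0 by auto
  \<comment> \<open>\<open>img u\<close> is \<open>q ^ (k - w)\<close> for the weight \<open>w\<close> of the point \<open>u\<close>; a point of least weight is chosen\<close>
  define img where "img u = card (bracket u ` U)" for u
  have "Max (img ` (U - {0})) \<in> img ` (U - {0})"
    using ne by (intro Max_in) auto
  then obtain u0 where u0_Max: "Max (img ` (U - {0})) = img u0" and "u0 \<in> U - {0}"
    by (rule imageE)
  then have u0: "u0 \<in> U" "u0 \<noteq> 0" by auto
  have img_le: "img u \<le> img u0" if "u \<in> U" "u \<noteq> 0" for u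
    unfolding u0_Max[symmetric] using that by (intro Max_ge) auto
  have "\<exists>p\<in>U. bracket u0 p \<noteq> 0"
  proof (rule ccontr)
    assume *: "\<not> ?thesis"
    have "L = {vec.span {u0}}"
      using u0 * span_eq_iff_bracket[OF u0(2)] unfolding L linear_set_def by fastforce
    also have "\<dots> = linear_set (vec.span {u0})"
    proof -
      have "vec.span {u} = vec.span {u0}" if "u \<in> vec.span {u0}" "u \<noteq> 0" for u
        using that span_eq_iff_bracket[OF u0(2) that(2)] bracket_eq_0_iff[OF u0(2)]
        by (auto simp: vec.span_singleton)
      moreover have "u0 \<in> vec.span {u0}" by (simp add: vec.span_base)
      ultimately show ?thesis using u0 unfolding linear_set_def by blast
    qed
    finally have "L = linear_set (vec.span {u0})" .
    moreover have "subspace_over UNIV (vec.span {u0})"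
      by (auto simp: subspace_over_def intro: vec.span_zero vec.span_add vec.span_scale)
    ultimately show False using not_UNIV unfolding linear_set_over_def by blast
  qed
  then obtain p0 where p0: "p0 \<in> U" "bracket p0 u0 \<noteq> 0" using bracket_swap by (metis neg_equal_0_iff_equal)
  have span_p0: "vec.span {p0} \<in> L"
    using p0 by (intro in_L[of p0]) (auto simp: bracket_def)
  \<comment> \<open>the parameters of the affine points of the linear set\<close>
  define Y where "Y p = {y. \<not> inj_on (\<lambda>u. bracket u0 u - y * bracket p u) U}" for p
  have img_Y: "img u0 \<le> card (Y p)" for p
  proof -
    have "bracket u0 0 = bracket u0 u0" by (simp add: bracket_def)
    then have "\<not> inj_on (\<lambda>u. bracket u0 u - 0 * bracket p u) U"
      using u0 U0 by (auto simp: inj_on_def)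
    then show ?thesis
      using card_zero_values_ge[of U "bracket u0" 0 "bracket p"] by (simp add: img_def Y_def)
  qed
  have Y_point: "\<exists>u\<in>U. u \<noteq> 0 \<and> bracket (u0 - y *s p) u = 0" if y: "y \<in> Y p" for y p
  proof -
    obtain u v where uv: "u \<in> U" "v \<in> U" "u \<noteq> v" "bracket (u0 - y *s p) u = bracket (u0 - y *s p) v"
      using y by (auto simp: Y_def inj_on_def bracket_diff_left)
    have "u - v \<in> U" using uv U(1) subspace_over_diff by blast
    moreover have "bracket (u0 - y *s p) (u - v) = bracket (u0 - y *s p) u - bracket (u0 - y *s p) v"
      by (simp add: bracket_def algebra_simps)
    ultimately show ?thesis using uv by (intro bexI[of _ "u - v"]) auto
  qed
  have nonzero: "u0 - y *s p \<noteq> 0" if "bracket p u0 \<noteq> 0" for y p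
  proof
    assume "u0 - y *s p = 0"
    then have "u0 = y *s p" by simp
    then show False using that by (simp add: bracket_def)
  qed
  show ?thesis
  proof (cases "img u0 < q ^ (k - 1)")
    case False
    \<comment> \<open>a point of weight one; another point of \<open>L\<close> at infinity contributes the summand one\<close>
    have "card (Y p0) + 1 \<le> card L"
    proof (rule card_ge_affine_part[OF p0(2) span_p0])
      fix y assume "y \<in> Y p0"
      then show "vec.span {u0 - y *s p0} \<in> L"
        using Y_point in_L nonzero[OF p0(2)] by blast
    qed
    then show ?thesis using img_Y[of p0] False by linarith
  next
    case True
    obtain m c where m: "img u0 = q ^ m"
      using F_subspace_annihilator[OF F_subspace_image[OF U(1), of "bracket u0"]]
      unfolding img_def by (metis bracket_add bracket_scale)
    have mk: "m + 2 \<le> k" using True m q by simp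
    show ?thesis
    proof (cases "\<exists>p. p \<noteq> 0 \<and> (\<forall>u\<in>U. u \<noteq> 0 \<longrightarrow> bracket p u \<noteq> 0)")
      case False
      \<comment> \<open>\<open>L\<close> is the whole line\<close>
      have "card (UNIV :: 'a set) + 1 \<le> card L"
      proof (rule card_ge_affine_part[OF p0(2) span_p0])
        fix y
        obtain u where "u \<in> U" "u \<noteq> 0" "bracket (u0 - y *s p0) u = 0"
          using False nonzero[OF p0(2)] by blast
        then show "vec.span {u0 - y *s p0} \<in> L" using in_L nonzero[OF p0(2)] by blast
      qed
      moreover have "q ^ (k - 1) \<le> q ^ n" using q \<open>k \<le> n\<close> by (intro power_increasing) auto
      ultimately show ?thesis using assms(3) by simp
    next
      case True
      then obtain p where p: "p \<noteq> 0" "\<And>u. u \<in> U \<Longrightarrow> u \<noteq> 0 \<Longrightarrow> bracket p u \<noteq> 0" by blast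
      have pu0: "bracket p u0 \<noteq> 0" using p u0 by blast
      have "\<exists>s>1. s dvd n \<and> linear_set_over {x :: 'a. x ^ q ^ s = x} (linear_set U)"
      proof (rule linear_over_extension[where \<alpha> = "bracket p" and \<beta> = "bracket u0",
            OF U(1) card_U bracket_add bracket_scale bracket_add bracket_scale _ _ _ mk])
        fix x assume x: "bracket p x = 0" "bracket u0 x = 0"
        then obtain c where "x = c *s p" using bracket_eq_0_iff[OF p(1)] by blast
        then show "x = 0" using x(2) pu0 bracket_swap[of u0 p] by (auto simp: bracket_scale)
      next
        fix u assume "u \<in> U" "bracket p u = 0"
        then show "u = 0" using p by blast
      next
        have "card ((\<lambda>u. bracket u0 u - y * bracket p u) ` U) \<le> q ^ m" if y: "y \<in> Y p" for y
        proof -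
          obtain u where u: "u \<in> U" "u \<noteq> 0" "bracket (u0 - y *s p) u = 0" using Y_point[OF y] by blast
          then have "bracket u (u0 - y *s p) = 0" using bracket_swap[of u] by simp
          then obtain c where "u0 - y *s p = c *s u" using bracket_eq_0_iff[OF u(2)] by blast
          then have "bracket u0 v - y * bracket p v = c * bracket u v" for v
            unfolding bracket_diff_left[symmetric] by (simp add: bracket_def algebra_simps)
          then have "(\<lambda>u. bracket u0 u - y * bracket p u) ` U = (\<lambda>x. c * x) ` bracket u ` U"
            by (simp add: image_image)
          then have "card ((\<lambda>u. bracket u0 u - y * bracket p u) ` U) \<le> img u"
            unfolding img_def by (simp add: card_image_le)
          then show ?thesis using img_le[OF u(1,2)] m by simp
        qed
        then have "card (Y p) \<le> card {y. card ((\<lambda>u. bracket u0 u - y * bracket p u) ` U) \<le> q ^ m}"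
          by (intro card_mono) auto
        then show "q ^ m \<le> card {y. card ((\<lambda>u. bracket u0 u - y * bracket p u) ` U) \<le> q ^ m}"
          using img_Y[of p] m by simp
      qed
      then obtain s where s: "s > 1" "s dvd n" "linear_set_over {x :: 'a. x ^ q ^ s = x} L"
        unfolding L by blast
      have "s \<le> 1"
        using s card_fixed_field[of s] fixed_field_subfield[of s] by (intro max[of s]) auto
      then show ?thesis using s by simp
    qed
  qed
qed

end
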